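(* Let $2<\delta<\gamma$, let $g=g_{\gamma,\delta}$ be the Double Hofbauer potential, and let $\mu_1$ be the $\sigma$-invariant probability $\mu_1=\varphi_1\nu_1$ (normalized), an equilibrium state of $g$ at the critical inverse temperature $\beta=1$. Let $[0]=\{x\in\Omega:x_0=0\}$. Then the correlations of $I_{[0]}$ decay polynomially: $$\int_\Omega (I_{[0]}\circ\sigma^q)\,\big[I_{[0]}-\mu_1([0])\big]\,d\mu_1\ \sim\ q^{2-\delta}\qquad(q\to\infty),$$ where $a_q\sim b_q$ means that the two sequences have the same asymptotic order, i.e. there are constants $0<c\le C<\infty$ with $c\,b_q\le a_q\le C\,b_q$ for all sufficiently large $q$.
   Context: $\Omega=\{0,1\}^{\mathbb N}$ with the left shift $\sigma$. For $n\ge1$, $L_n\subset\Omega$ is the set of sequences beginning with exactly $n$ zeros followed by a $1$, and $R_n$ the set of sequences beginning with exactly $n$ ones followed by a $0$; $\zeta$ is the Riemann zeta function. The Double Hofbauer potential with parameters $1<\delta<\gamma$ is $g=-\gamma\log\frac{n}{n-1}$ on $L_n$ and $g=-\delta\log\frac n{n-1}$ on $R_n$ for $n\ge2$, $g=-\log\zeta(\gamma)$ on $L_1$, $g=-\log\zeta(\delta)$ on $R_1$, $g(0^\infty)=g(1^\infty)=0$. The Ruelle operator is $\mathcal L_g(\psi)(x)=\sum_{\sigma(y)=x}e^{g(y)}\psi(y)$, with dual defined by $\int\psi\,d\mathcal L_g^*(\mu)=\int\mathcal L_g(\psi)\,d\mu$ for $\psi\in C(\Omega)$. $\nu_1$ is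 the (unique) Borel probability measure with $\mathcal L_g^*\nu_1=\nu_1$; it has no atoms. $\varphi_1$ is the positive eigenfunction ($\mathcal L_g\varphi_1=\varphi_1$) given, up to a constant factor, by $\varphi_1(x)=1+n^{\gamma}\sum_{j\ge2}(j+n-1)^{-\gamma}$ for $x\in L_n$, $\varphi_1(x)=1+n^{\delta}\sum_{j\ge2}(j+n-1)^{-\delta}$ for $x\in R_n$, and $+\infty$ at $0^\infty,1^\infty$. For $\gamma,\delta>2$ the function $\varphi_1$ is $\nu_1$-integrable and $\mu_1$ is the probability measure proportional to $\varphi_1\nu_1$. *)

theory Defs
  imports "HOL-Probability.Probability"
begin

text \<open>
  The full shift on two symbols is modelled by the type \<open>nat \<Rightarrow> bool\<close>, where \<open>False\<close> is the
  symbol 0 and \<open>True\<close> is the symbol 1. The topology is the product topology of the library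
  (\<open>bool\<close> being discrete), and \<open>borel\<close> is the Borel sigma-algebra of that topology.
\<close>

type_synonym binseq = "nat \<Rightarrow> bool"

definition shift :: "binseq \<Rightarrow> binseq" where
  "shift x = (\<lambda>i. x (Suc i))"

definition zeros :: binseq where "zeros = (\<lambda>_. False)"
definition ones :: binseq where "ones = (\<lambda>_. True)"

definition cyl0 :: "binseq set" where "cyl0 = {x. \<not> x 0}"

text \<open>Used only for \<open>n \<ge> 1\<close>; the sets \<open>L_block 0\<close> and \<open>R_block 0\<close> play no role.\<close>

definition L_block :: "nat \<Rightarrow> binseq set" where
  "L_block n = {x. (\<forall>i<n. \<not> x i) \<and> x n}"

definition R_block :: "nat \<Rightarrow> binseq set" where
  "R_block n = {x. (\<forall>i<n. x i) \<and> \<not> x n}"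

text \<open>Length of the initial constant block; meaningless on the two constant sequences.\<close>

definition run_length :: "binseq \<Rightarrow> nat" where
  "run_length x = (THE n. n \<ge> 1 \<and> x \<in> L_block n \<union> R_block n)"

text \<open>The Riemann zeta function at real arguments \<open>s > 1\<close>, the only ones that occur.\<close>

definition zeta :: "real \<Rightarrow> real" where
  "zeta s = (\<Sum>\<^sub>\<infinity>n\<in>{1..}. real n powr (- s))"

definition hofbauer_branch :: "real \<Rightarrow> nat \<Rightarrow> real" where
  "hofbauer_branch s n =
     (if n = 1 then - ln (zeta s) else - s * ln (real n / (real n - 1)))"

definition double_hofbauer :: "real \<Rightarrow> real \<Rightarrow> binseq \<Rightarrow> real" where
  "double_hofbauer \<gamma> \<delta> x =
     (if x = zeros \<or> x = ones then 0
      else hofbauer_branch (if x 0 then \<delta> else \<gamma>) (run_length x))"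

definition ruelle :: "(binseq \<Rightarrow> real) \<Rightarrow> (binseq \<Rightarrow> real) \<Rightarrow> binseq \<Rightarrow> real" where
  "ruelle g \<psi> x = (\<Sum>y | shift y = x. exp (g y) * \<psi> y)"

text \<open>\<open>ruelle_dual g \<mu> \<rho>\<close> says that \<open>\<rho>\<close> is the image of \<open>\<mu>\<close> under the dual of the Ruelle operator.\<close>

definition ruelle_dual :: "(binseq \<Rightarrow> real) \<Rightarrow> binseq measure \<Rightarrow> binseq measure \<Rightarrow> bool" where
  "ruelle_dual g \<mu> \<rho> \<longleftrightarrow>
     finite_measure \<rho> \<and> sets \<rho> = sets borel \<and>
     (\<forall>\<psi>. continuous_on UNIV \<psi> \<longrightarrow> (\<integral>x. \<psi> x \<partial>\<rho>) = (\<integral>x. ruelle g \<psi> x \<partial>\<mu>))"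

definition eigenprobability :: "(binseq \<Rightarrow> real) \<Rightarrow> binseq measure \<Rightarrow> bool" where
  "eigenprobability g \<nu> \<longleftrightarrow> prob_space \<nu> \<and> sets \<nu> = sets borel \<and> ruelle_dual g \<nu> \<nu>"

definition eigenfunction_branch :: "real \<Rightarrow> nat \<Rightarrow> real" where
  "eigenfunction_branch s n =
     1 + real n powr s * (\<Sum>\<^sub>\<infinity>j\<in>{2..}. real (j + n - 1) powr (- s))"

definition eigenfunction :: "real \<Rightarrow> real \<Rightarrow> binseq \<Rightarrow> ennreal" where
  "eigenfunction \<gamma> \<delta> x =
     (if x = zeros \<or> x = ones then \<infinity>
      else ennreal (eigenfunction_branch (if x 0 then \<delta> else \<gamma>) (run_length x)))"

definition equilibrium :: "real \<Rightarrow> real \<Rightarrow> binseq measure \<Rightarrow> binseq measure" where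
  "equilibrium \<gamma> \<delta> \<nu> =
     density \<nu> (\<lambda>x. eigenfunction \<gamma> \<delta> x / (\<integral>\<^sup>+ y. eigenfunction \<gamma> \<delta> y \<partial>\<nu>))"

text \<open>Sanity checks: the definitions by initial block length agree with the piecewise ones.\<close>

lemma run_length_L: "n \<ge> 1 \<Longrightarrow> x \<in> L_block n \<Longrightarrow> run_length x = n"
  unfolding run_length_def
proof (rule the_equality)
  fix m assume *: "n \<ge> 1" "x \<in> L_block n" "m \<ge> 1 \<and> x \<in> L_block m \<union> R_block m"
  then have "\<not> x 0" by (auto simp: L_block_def)
  with * have "x \<in> L_block m" by (auto simp: R_block_def)
  with * show "m = n" by (auto simp: L_block_def) (metis linorder_neqE_nat)
qed auto

lemma run_length_R: "n \<ge> 1 \<Longrightarrow> x \<in> R_block n \<Longrightarrow> run_length x = n"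
  unfolding run_length_def
proof (rule the_equality)
  fix m assume *: "n \<ge> 1" "x \<in> R_block n" "m \<ge> 1 \<and> x \<in> L_block m \<union> R_block m"
  then have "x 0" by (auto simp: R_block_def)
  with * have "x \<in> R_block m" by (auto simp: L_block_def)
  with * show "m = n" by (auto simp: R_block_def) (metis linorder_neqE_nat)
qed auto

lemma L_not_const: "n \<ge> 1 \<Longrightarrow> x \<in> L_block n \<Longrightarrow> \<not> x 0 \<and> x \<noteq> zeros \<and> x \<noteq> ones"
  by (auto simp: L_block_def zeros_def ones_def)

lemma R_not_const: "n \<ge> 1 \<Longrightarrow> x \<in> R_block n \<Longrightarrow> x 0 \<and> x \<noteq> zeros \<and> x \<noteq> ones"
  by (auto simp: R_block_def zeros_def ones_def)

lemma double_hofbauer_cases: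
  "double_hofbauer \<gamma> \<delta> zeros = 0"
  "double_hofbauer \<gamma> \<delta> ones = 0"
  "x \<in> L_block 1 \<Longrightarrow> double_hofbauer \<gamma> \<delta> x = - ln (zeta \<gamma>)"
  "x \<in> R_block 1 \<Longrightarrow> double_hofbauer \<gamma> \<delta> x = - ln (zeta \<delta>)"
  "n \<ge> 2 \<Longrightarrow> x \<in> L_block n \<Longrightarrow> double_hofbauer \<gamma> \<delta> x = - \<gamma> * ln (real n / (real n - 1))"
  "n \<ge> 2 \<Longrightarrow> x \<in> R_block n \<Longrightarrow> double_hofbauer \<gamma> \<delta> x = - \<delta> * ln (real n / (real n - 1))"
  using run_length_L[of n x] run_length_R[of n x] run_length_L[of 1 x] run_length_R[of 1 x]
    L_not_const[of n x] R_not_const[of n x] L_not_const[of 1 x] R_not_const[of 1 x]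
  by (simp_all add: double_hofbauer_def hofbauer_branch_def)

lemma eigenfunction_cases:
  "eigenfunction \<gamma> \<delta> zeros = \<infinity>"
  "eigenfunction \<gamma> \<delta> ones = \<infinity>"
  "n \<ge> 1 \<Longrightarrow> x \<in> L_block n \<Longrightarrow> eigenfunction \<gamma> \<delta> x = ennreal (eigenfunction_branch \<gamma> n)"
  "n \<ge> 1 \<Longrightarrow> x \<in> R_block n \<Longrightarrow> eigenfunction \<gamma> \<delta> x = ennreal (eigenfunction_branch \<delta> n)"
  using run_length_L[of n x] run_length_R[of n x] L_not_const[of n x] R_not_const[of n x]
  by (simp_all add: eigenfunction_def)

end

theory Submission
  imports Defs "HOL-Complex_Analysis.Complex_Analysis" "HOL-Real_Asymp.Real_Asymp"
begin

text \<open>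
  Under the eigenmeasure \<open>\<nu>\<close> a sequence is a concatenation of independent blocks, alternately of zeros and
  of ones, whose lengths have the laws \<open>k powr - \<gamma> / zeta \<gamma>\<close> and \<open>k powr - \<delta> / zeta \<delta>\<close>
  (\<open>measure_after_block\<close>). Multiplication by the eigenfunction replaces the law of the first block by
  its stationary version (\<open>branch_block\<close>), so that the equilibrium measure is a stationary alternating
  renewal process.

  Let \<open>A\<close> and \<open>B\<close> be the generating functions of the survival probabilities of the two kinds of blocks,
  let \<open>m0 = A(1)\<close> and \<open>m1 = B(1)\<close> be the mean lengths, and let \<open>D = A + B - (1 - X) A B\<close> be the generating
  function of the survival probabilities of a full cycle. The renewal equations combine to
  \<open>(1 - X) K = (m0 m1 / (m0 + m1) - V) / (m0 + m1)\<close> with \<open>V = X A B / D\<close>, where \<open>K\<close> is the generating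
  function of the covariances (\<open>cov_fps_eq\<close>, \<open>covariance_eq\<close>). Since \<open>V(1) = m0 m1 / (m0 + m1)\<close>, the
  \<open>q\<close>-th covariance is the tail beyond \<open>q\<close> of the coefficients of \<open>V\<close>, divided by \<open>m0 + m1\<close>.

  The coefficients of \<open>B\<close> are asymptotic to a multiple of \<open>n powr (1 - \<delta>)\<close>, which is summable as
  \<open>\<delta> > 2\<close>; those of \<open>A\<close> are of smaller order. Asymptotics of this kind pass to products
  (\<open>has_tail_mult\<close>), and to inverses of series without zeros in the closed unit disc
  (\<open>has_tail_inverse\<close>). The latter rests on a version of Wiener's lemma that preserves the rate of decay
  (\<open>inverse_decays\<close>). Hence the coefficients of \<open>V\<close> are asymptotic to a multiple of
  \<open>n powr (1 - \<delta>)\<close>, the factor being positive (\<open>covariance_asymptotics\<close>), and summation over the tail gives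
  the rate \<open>q powr (2 - \<delta>)\<close>.
\<close>

unbundle no vec_syntax

section \<open>Absolutely summable power series\<close>

definition l1_fps :: "real fps \<Rightarrow> bool" where
  "l1_fps F \<longleftrightarrow> summable (\<lambda>k. \<bar>F $ k\<bar>)"

text \<open>Total by the convention for divergent series; meaningful for \<open>l1_fps F\<close> and \<open>norm z \<le> 1\<close>.\<close>

definition fps_value :: "real fps \<Rightarrow> 'a::{real_normed_field,banach} \<Rightarrow> 'a" where
  "fps_value F z = (\<Sum>k. of_real (F $ k) * z ^ k)"

text \<open>A bound for all partial sums together with a pointwise power bound. Keeping both constants explicit
  is what allows high powers of a series to be estimated.\<close>

definition decays :: "real \<Rightarrow> real \<Rightarrow> real \<Rightarrow> real fps \<Rightarrow> bool" where
  "decays s N C F \<longleftrightarrow> (\<forall>n. (\<Sum>i\<le>n. \<bar>F $ i\<bar>) \<le> N) \<and> (\<forall>k\<ge>1. \<bar>F $ k\<bar> \<le> C * real k powr (- s))"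

lemma decays_nonneg:
  assumes "decays s N C F" shows "0 \<le> N" "0 \<le> C"
proof -
  have "0 \<le> (\<Sum>i\<le>0::nat. \<bar>F $ i\<bar>)" by simp
  also have "\<dots> \<le> N" using assms unfolding decays_def by blast
  finally show "0 \<le> N" .
  have "\<bar>F $ 1\<bar> \<le> C * real 1 powr (- s)" using assms unfolding decays_def by blast
  then show "0 \<le> C" by simp
qed

lemma l1_sum_mult_le:
  fixes F G :: "real fps"
  assumes "\<And>n. (\<Sum>i\<le>n. \<bar>F $ i\<bar>) \<le> N" "\<And>n. (\<Sum>i\<le>n. \<bar>G $ i\<bar>) \<le> M"
  shows "(\<Sum>i\<le>n. \<bar>(F * G) $ i\<bar>) \<le> N * M"
proof -
  have N: "0 \<le> N" using assms(1)[of 0] by simp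
  have "(\<Sum>k\<le>n. \<bar>(F * G) $ k\<bar>) \<le> (\<Sum>k\<le>n. \<Sum>i\<le>k. \<bar>F $ i\<bar> * \<bar>G $ (k - i)\<bar>)"
    unfolding fps_mult_nth atLeast0AtMost
    by (intro sum_mono order_trans[OF sum_abs]) (simp add: abs_mult)
  also have "\<dots> = (\<Sum>(i,j)\<in>{(i,j). i + j \<le> n}. \<bar>F $ i\<bar> * \<bar>G $ j\<bar>)"
    by (rule sum.triangle_reindex_eq[symmetric])
  also have "\<dots> \<le> (\<Sum>(i,j)\<in>{..n} \<times> {..n}. \<bar>F $ i\<bar> * \<bar>G $ j\<bar>)"
    by (rule sum_mono2) auto
  also have "\<dots> = (\<Sum>i\<le>n. \<bar>F $ i\<bar>) * (\<Sum>j\<le>n. \<bar>G $ j\<bar>)"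
    by (simp add: sum_product sum.cartesian_product)
  also have "\<dots> \<le> N * M"
    using assms N by (intro mult_mono) (auto intro: sum_nonneg)
  finally show ?thesis .
qed

text \<open>At least one of the two indices of a term of the convolution is large: either \<open>i \<ge> l * k\<close> or
  \<open>k - i \<ge> (1 - l) * k\<close>. The large index supplies the power of \<open>k\<close>, and summation over the other
  one uses the \<open>l1\<close> bound. The free parameter \<open>l\<close> keeps the constants of iterated products polynomial.\<close>

lemma decays_mult:
  assumes F: "decays s N C F" and G: "decays s M D G" and s: "0 \<le> s" and l: "0 < l" "l < 1"
  shows "decays s (N * M) (l powr (- s) * C * M + (1 - l) powr (- s) * N * D) (F * G)"
  unfolding decays_def
proof (intro conjI allI impI)
  fix n show "(\<Sum>i\<le>n. \<bar>(F * G) $ i\<bar>) \<le> N * M"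
    using F G by (intro l1_sum_mult_le) (auto simp: decays_def)
next
  fix k :: nat assume k: "1 \<le> k"
  note nn = decays_nonneg[OF F] decays_nonneg[OF G]
  define x where "x = l powr (- s) * C * real k powr (- s)"
  define y where "y = (1 - l) powr (- s) * D * real k powr (- s)"
  have xy: "0 \<le> x" "0 \<le> y" using nn by (auto simp: x_def y_def)
  have trm: "\<bar>F $ i * G $ (k - i)\<bar> \<le> x * \<bar>G $ (k - i)\<bar> + y * \<bar>F $ i\<bar>" if i: "i \<le> k" for i
  proof (cases "l * real k \<le> real i")
    case True
    have "0 < l * real k" using l k by simp
    with True have i1: "1 \<le> i" by (cases i) auto
    have "\<bar>F $ i\<bar> \<le> C * real i powr (- s)" using F i1 by (auto simp: decays_def)
    also have "\<dots> \<le> C * (l * real k) powr (- s)"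
      using True l k s nn by (intro mult_left_mono powr_mono2') auto
    also have "\<dots> = x" using l by (simp add: x_def powr_mult)
    finally have "\<bar>F $ i * G $ (k - i)\<bar> \<le> x * \<bar>G $ (k - i)\<bar>"
      by (auto simp: abs_mult intro: mult_right_mono)
    then show ?thesis using xy by (smt (verit) mult_nonneg_nonneg abs_ge_zero)
  next
    case False
    have le: "(1 - l) * real k \<le> real (k - i)" using False i by (simp add: of_nat_diff algebra_simps)
    have "0 < (1 - l) * real k" using l k by simp
    with le have i1: "1 \<le> k - i" by (cases "k - i") auto
    have "\<bar>G $ (k - i)\<bar> \<le> D * real (k - i) powr (- s)" using G i1 by (auto simp: decays_def)
    also have "\<dots> \<le> D * ((1 - l) * real k) powr (- s)"
      using le l k s nn by (intro mult_left_mono powr_mono2') auto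
    also have "\<dots> = y" using l by (simp add: y_def powr_mult)
    finally have "\<bar>F $ i * G $ (k - i)\<bar> \<le> y * \<bar>F $ i\<bar>"
      by (simp add: abs_mult mult.commute[of y] mult_left_mono)
    then show ?thesis using xy by (smt (verit) mult_nonneg_nonneg abs_ge_zero)
  qed
  have "\<bar>(F * G) $ k\<bar> \<le> (\<Sum>i\<le>k. \<bar>F $ i * G $ (k - i)\<bar>)"
    unfolding fps_mult_nth atLeast0AtMost by (rule sum_abs)
  also have "\<dots> \<le> (\<Sum>i\<le>k. x * \<bar>G $ (k - i)\<bar> + y * \<bar>F $ i\<bar>)"
    by (intro sum_mono trm) auto
  also have "\<dots> = x * (\<Sum>i\<le>k. \<bar>G $ (k - i)\<bar>) + y * (\<Sum>i\<le>k. \<bar>F $ i\<bar>)"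
    by (simp add: sum.distrib sum_distrib_left)
  also have "(\<Sum>i\<le>k. \<bar>G $ (k - i)\<bar>) = (\<Sum>i\<le>k. \<bar>G $ i\<bar>)"
    by (rule sum.nat_diff_reindex[of "\<lambda>i. \<bar>G $ i\<bar>" "Suc k", unfolded lessThan_Suc_atMost, simplified])
  also have "x * (\<Sum>i\<le>k. \<bar>G $ i\<bar>) + y * (\<Sum>i\<le>k. \<bar>F $ i\<bar>) \<le> x * M + y * N"
    using F G xy by (intro add_mono mult_left_mono) (auto simp: decays_def)
  also have "\<dots> = (l powr (- s) * C * M + (1 - l) powr (- s) * N * D) * real k powr (- s)"
    by (simp add: x_def y_def algebra_simps)
  finally show "\<bar>(F * G) $ k\<bar> \<le> \<dots>" .
qed

text \<open>Splitting off one of the \<open>n + 1\<close> factors at \<open>l = 1 / (n + 1)\<close> makes the constants telescope, so that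
  the pointwise constant exceeds the expected \<open>N ^ n\<close> only by a polynomial in \<open>n\<close>.\<close>

lemma decays_power:
  assumes F: "decays s N C F" and s: "0 \<le> s"
  shows "decays s (N ^ Suc n) (C * real (Suc n) powr (s + 1) * N ^ n) (F ^ Suc n)"
proof (induction n)
  case 0 then show ?case using F by simp
next
  case (Suc n)
  define m where "m = real (Suc n)"
  have m: "0 < m" "real (Suc (Suc n)) = m + 1" by (auto simp: m_def)
  have "decays s (N * N ^ Suc n)
      ((1 / (m + 1)) powr (- s) * C * N ^ Suc n + (1 - 1 / (m + 1)) powr (- s) * N * (C * m powr (s + 1) * N ^ n))
      (F * F ^ Suc n)"
    using m unfolding m_def by (intro decays_mult F Suc s) (auto simp: m_def)
  moreover have "(1 / (m + 1)) powr (- s) * C * N ^ Suc n + (1 - 1 / (m + 1)) powr (- s) * N * (C * m powr (s + 1) * N ^ n)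
      = C * real (Suc (Suc n)) powr (s + 1) * N ^ Suc n"
  proof -
    have 1: "(1 / (m + 1)) powr (- s) = (m + 1) powr s"
      using m by (simp add: powr_divide powr_minus)
    have "1 - 1 / (m + 1) = m / (m + 1)" using m by (simp add: field_simps)
    then have 2: "(1 - 1 / (m + 1)) powr (- s) * m powr (s + 1) = m * (m + 1) powr s"
      using m by (simp add: powr_divide powr_minus powr_add field_simps)
    have "(1 - 1 / (m + 1)) powr (- s) * N * (C * m powr (s + 1) * N ^ n)
        = C * N ^ Suc n * ((1 - 1 / (m + 1)) powr (- s) * m powr (s + 1))"
      by (simp only: power_Suc mult_ac)
    also have "\<dots> = C * N ^ Suc n * (m * (m + 1) powr s)" by (simp only: 2)
    finally show ?thesis using m unfolding 1 m(2) by (simp add: powr_add algebra_simps)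
  qed
  ultimately show ?case by (simp only: power_Suc)
qed

lemma decays_power_all:
  assumes F: "decays s N C F" and s: "0 \<le> s" and N: "0 < N"
  shows "decays s (N ^ n) (C * real n powr (s + 1) * N ^ n / N) (F ^ n)"
proof (cases n)
  case 0
  then show ?thesis by (auto simp: decays_def fps_one_nth sum.delta' if_distrib cong: if_cong)
next
  case (Suc m)
  then show ?thesis using decays_power[OF F s, of m] N by (simp add: mult.assoc)
qed

lemma l1_sum_le: "l1_fps F \<Longrightarrow> (\<Sum>i\<le>n. \<bar>F $ i\<bar>) \<le> (\<Sum>i. \<bar>F $ i\<bar>)"
  unfolding l1_fps_def by (intro sum_le_suminf) auto

lemma l1_fpsI: "(\<And>n. (\<Sum>i\<le>n. \<bar>F $ i\<bar>) \<le> N) \<Longrightarrow> l1_fps F"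
  unfolding l1_fps_def by (rule bounded_imp_summable) auto

lemma decays_l1: "decays s N C F \<Longrightarrow> l1_fps F"
  unfolding decays_def by (blast intro: l1_fpsI)

lemma l1_mult [intro]: "l1_fps F \<Longrightarrow> l1_fps G \<Longrightarrow> l1_fps (F * G)"
  by (rule l1_fpsI, rule l1_sum_mult_le) (erule l1_sum_le)+

lemma l1_add [intro]: "l1_fps F \<Longrightarrow> l1_fps G \<Longrightarrow> l1_fps (F + G)"
  unfolding l1_fps_def by (rule summable_comparison_test'[OF summable_add, of "\<lambda>k. \<bar>F $ k\<bar>" "\<lambda>k. \<bar>G $ k\<bar>" 0]) auto

lemma l1_diff [intro]: "l1_fps F \<Longrightarrow> l1_fps G \<Longrightarrow> l1_fps (F - G)"
  unfolding l1_fps_def by (rule summable_comparison_test'[OF summable_add, of "\<lambda>k. \<bar>F $ k\<bar>" "\<lambda>k. \<bar>G $ k\<bar>" 0]) auto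

lemma l1_1 [intro]: "l1_fps 1" and l1_X [intro]: "l1_fps fps_X"
  unfolding l1_fps_def by (rule summable_finite[of "{0,1}"]; auto)+

lemma norm_of_real_mult_power_le:
  fixes z :: "'a::real_normed_div_algebra"
  assumes "norm z \<le> 1"
  shows "norm (of_real c * z ^ k) \<le> \<bar>c\<bar>"
proof -
  have "norm (of_real c * z ^ k) = \<bar>c\<bar> * norm z ^ k" by (simp only: norm_mult norm_power norm_of_real)
  also have "\<dots> \<le> \<bar>c\<bar> * 1" using assms by (intro mult_left_mono power_le_one) auto
  finally show ?thesis by (simp only: mult_1_right)
qed

lemma l1_summable_value:
  fixes z :: "'a::{real_normed_field,banach}"
  assumes "l1_fps F" "norm z \<le> 1"
  shows "summable (\<lambda>k. norm (of_real (F $ k) * z ^ k))" "summable (\<lambda>k. of_real (F $ k) * z ^ k)"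
proof -
  show "summable (\<lambda>k. norm (of_real (F $ k) * z ^ k))"
  proof (rule summable_comparison_test')
    show "summable (\<lambda>k. \<bar>F $ k\<bar>)" using assms(1) by (simp add: l1_fps_def)
    show "norm (norm (of_real (F $ k) * z ^ k)) \<le> \<bar>F $ k\<bar>" for k
      unfolding real_norm_def abs_norm_cancel by (rule norm_of_real_mult_power_le[OF assms(2)])
  qed
  then show "summable (\<lambda>k. of_real (F $ k) * z ^ k)" by (rule summable_norm_cancel)
qed

lemma fps_value_mult:
  fixes z :: "'a::{real_normed_field,banach}"
  assumes "l1_fps F" "l1_fps G" "norm z \<le> 1"
  shows "fps_value (F * G) z = fps_value F z * fps_value G z"
proof -
  have "fps_value F z * fps_value G z
      = (\<Sum>k. \<Sum>i\<le>k. (of_real (F $ i) * z ^ i) * (of_real (G $ (k - i)) * z ^ (k - i)))"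
    unfolding fps_value_def by (intro Cauchy_product l1_summable_value assms)
  also have "\<dots> = fps_value (F * G) z"
    unfolding fps_value_def
  proof (rule suminf_cong)
    fix k
    have "(\<Sum>i\<le>k. (of_real (F $ i) * z ^ i) * (of_real (G $ (k - i)) * z ^ (k - i)))
        = (\<Sum>i\<le>k. of_real (F $ i * G $ (k - i)) * z ^ k)"
    proof (rule sum.cong[OF refl])
      fix i assume "i \<in> {..k}"
      then have "z ^ k = z ^ i * z ^ (k - i)" by (simp add: power_add[symmetric])
      then show "(of_real (F $ i) * z ^ i) * (of_real (G $ (k - i)) * z ^ (k - i))
          = of_real (F $ i * G $ (k - i)) * z ^ k" by (simp only: of_real_mult mult_ac)
    qed
    then show "(\<Sum>i\<le>k. (of_real (F $ i) * z ^ i) * (of_real (G $ (k - i)) * z ^ (k - i)))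
        = of_real ((F * G) $ k) * z ^ k"
      by (simp only: fps_mult_nth sum_distrib_right atLeast0AtMost of_real_sum)
  qed
  finally show ?thesis by (rule sym)
qed

lemma fps_value_add:
  fixes z :: "'a::{real_normed_field,banach}"
  assumes "l1_fps F" "l1_fps G" "norm z \<le> 1"
  shows "fps_value (F + G) z = fps_value F z + fps_value G z"
  using suminf_add[OF l1_summable_value(2)[OF assms(1,3)] l1_summable_value(2)[OF assms(2,3)]]
  unfolding fps_value_def by (simp only: fps_add_nth of_real_add distrib_right)

lemma fps_value_diff:
  fixes z :: "'a::{real_normed_field,banach}"
  assumes "l1_fps F" "l1_fps G" "norm z \<le> 1"
  shows "fps_value (F - G) z = fps_value F z - fps_value G z"
  using suminf_diff[OF l1_summable_value(2)[OF assms(1,3)] l1_summable_value(2)[OF assms(2,3)]]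
  unfolding fps_value_def by (simp only: fps_sub_nth of_real_diff left_diff_distrib)

lemma fps_value_1 [simp]: "fps_value 1 z = 1"
proof -
  have "(\<Sum>k. of_real (1 $ k) * z ^ k) = (\<Sum>k\<in>{0::nat}. of_real ((1::real fps) $ k) * z ^ k)"
    by (rule suminf_finite) auto
  then show ?thesis by (simp add: fps_value_def)
qed

lemma fps_value_X [simp]: "fps_value fps_X z = z"
proof -
  have "(\<Sum>k. of_real (fps_X $ k) * z ^ k) = (\<Sum>k\<in>{1::nat}. of_real ((fps_X::real fps) $ k) * z ^ k)"
    by (rule suminf_finite) (auto simp: fps_X_nth)
  then show ?thesis by (simp add: fps_value_def)
qed

section \<open>Wiener's lemma with a polynomial rate\<close>

text \<open>Cauchy's inequality on the circle of radius \<open>R\<close>, applied to the powers of the reciprocal of a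
  polynomial that is bounded below by \<open>\<kappa>\<close> on the disc.\<close>

lemma inverse_power_coeff_bound:
  fixes P :: "real fps"
  assumes fin: "\<And>k. N \<le> k \<Longrightarrow> P $ k = 0" and R: "0 < R" and \<kappa>: "0 < \<kappa>"
    and lower: "\<And>z::complex. norm z \<le> R \<Longrightarrow> \<kappa> \<le> norm (\<Sum>k<N. of_real (P $ k) * z ^ k)"
  shows "\<bar>(inverse P ^ n) $ k\<bar> \<le> (1 / \<kappa>) ^ n * (1 / R) ^ k"
proof -
  define f where "f = (\<lambda>z::complex. \<Sum>k<N. of_real (P $ k) * z ^ k)"
  define co where "co = (\<lambda>F::real fps. Abs_fps (\<lambda>k. complex_of_real (F $ k)))"
  have co_mult: "co (F * G) = co F * co G" for F G
    by (rule fps_ext) (simp add: co_def fps_mult_nth)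
  have co_1: "co 1 = 1" by (rule fps_ext) (simp add: co_def)
  have co_power: "co (F ^ n) = co F ^ n" for F n by (induction n) (auto simp: co_1 co_mult)
  have N: "N > 0" using lower[of 0] R \<kappa> by (cases N) auto
  have "f 0 = of_real (P $ 0)"
    unfolding f_def using N by (subst sum.mono_neutral_right[of _ "{0}"]) (auto simp: power_0_left)
  then have P0: "P $ 0 \<noteq> 0" using lower[of 0] R \<kappa> by (auto simp: f_def)
  have coP: "co P = (\<Sum>k<N. fps_const (of_real (P $ k)) * fps_X ^ k)"
    by (rule fps_ext) (auto simp: co_def fps_sum_nth fin if_distrib cong: if_cong)
  have "f has_fps_expansion co P"
    unfolding coP f_def by (intro fps_expansion_intros)
  moreover have "co P $ 0 \<noteq> 0" using P0 by (simp add: co_def)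
  ultimately have "(\<lambda>z. inverse (f z) ^ n) has_fps_expansion inverse (co P) ^ n"
    by (intro fps_expansion_intros)
  moreover have "inverse (co P) = co (inverse P)"
    using P0 by (intro fps_inverse_unique) (simp add: co_mult[symmetric] co_1 inverse_mult_eq_1')
  ultimately have "(\<lambda>z. inverse (f z) ^ n) has_fps_expansion co (inverse P ^ n)"
    by (simp add: co_power)
  then have nth: "co (inverse P ^ n) $ k = (deriv ^^ k) (\<lambda>z. inverse (f z) ^ n) 0 / fact k"
    by (rule fps_nth_fps_expansion)
  have nz: "f z \<noteq> 0" if "norm z \<le> R" for z using lower[OF that] \<kappa> by (auto simp: f_def)
  have hol: "f holomorphic_on A" for A unfolding f_def by (intro holomorphic_intros)
  have "norm ((deriv ^^ k) (\<lambda>z. inverse (f z) ^ n) 0) \<le> fact k * ((1 / \<kappa>) ^ n) / R ^ k"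
  proof (rule Cauchy_inequality)
    show "(\<lambda>z. inverse (f z) ^ n) holomorphic_on ball 0 R"
      using nz by (intro holomorphic_intros hol) auto
    show "continuous_on (cball 0 R) (\<lambda>z. inverse (f z) ^ n)"
      using nz by (intro continuous_intros holomorphic_on_imp_continuous_on[OF hol]) auto
    show "norm (inverse (f x) ^ n) \<le> (1 / \<kappa>) ^ n" if "norm (0 - x) = R" for x
    proof -
      have "\<kappa> \<le> norm (f x)" using lower[of x] that by (simp add: f_def)
      then have "inverse (norm (f x)) \<le> 1 / \<kappa>"
        using \<kappa> by (simp add: inverse_eq_divide frac_le)
      then show ?thesis unfolding norm_power norm_inverse by (intro power_mono) auto
    qed
  qed (fact R)
  then have "norm ((deriv ^^ k) (\<lambda>z. inverse (f z) ^ n) 0) / fact k \<le> (1 / \<kappa>) ^ n / R ^ k"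
    by (simp add: pos_divide_le_eq mult.commute)
  moreover have "\<bar>(inverse P ^ n) $ k\<bar> = norm (co (inverse P ^ n) $ k)" by (simp add: co_def)
  moreover have "norm (co (inverse P ^ n) $ k) = norm ((deriv ^^ k) (\<lambda>z. inverse (f z) ^ n) 0) / fact k"
    unfolding nth norm_divide by simp
  moreover have "(1 / \<kappa>) ^ n / R ^ k = (1 / \<kappa>) ^ n * (1 / R) ^ k"
    by (simp only: power_one_over divide_inverse mult_1_left power_inverse)
  ultimately show ?thesis by linarith
qed

text \<open>Wiener's lemma in the form needed here, by Newman's argument. Split \<open>F = P - h\<close> with a polynomial
  \<open>P\<close> and a remainder whose \<open>l1\<close> norm is at most \<open>\<epsilon>\<close>, a third of the minimum of \<open>|F|\<close> on the
  closed disc. By continuity \<open>P\<close> stays above \<open>\<kappa> > \<epsilon>\<close> on a slightly larger disc, so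
  that \<open>P ^ (-n)\<close> has \<open>l1\<close> norm at most a constant times \<open>\<kappa> ^ (-n)\<close>, whereas \<open>h ^ n\<close> has norm
  at most \<open>\<epsilon> ^ n\<close>. Hence the Neumann series \<open>\<Sum>n. h ^ n / P ^ (n + 1)\<close> for \<open>1 / F\<close>
  converges. The same series bounds the coefficients pointwise, because the pointwise constants of
  \<open>h ^ n\<close> exceed \<open>\<epsilon> ^ n\<close> by a polynomial factor only.\<close>

lemma inverse_decays:
  assumes F: "decays s N C F" and s: "0 \<le> s"
    and nz: "\<And>z::complex. norm z \<le> 1 \<Longrightarrow> fps_value F z \<noteq> 0"
  shows "\<exists>N' C'. decays s N' C' (inverse F)"
proof -
  have l1: "l1_fps F" using F by (rule decays_l1)
  have cont: "continuous_on (cball 0 1) (fps_value F :: complex \<Rightarrow> complex)"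
  proof -
    have "uniform_limit (cball 0 1) (\<lambda>n z::complex. \<Sum>k<n. of_real (F $ k) * z ^ k) (fps_value F) sequentially"
      unfolding fps_value_def using l1 unfolding l1_fps_def
      by (intro Weierstrass_m_test[where M = "\<lambda>k. \<bar>F $ k\<bar>"] norm_of_real_mult_power_le) auto
    then show ?thesis
      by (rule uniform_limit_theorem[rotated]) (auto intro!: always_eventually continuous_intros)
  qed
  obtain z0 :: complex where z0: "norm z0 \<le> 1"
      "\<And>z::complex. norm z \<le> 1 \<Longrightarrow> norm (fps_value F z0) \<le> norm (fps_value F z)"
    using continuous_attains_inf[of "cball 0 1" "\<lambda>z::complex. norm (fps_value F z)"] continuous_on_norm[OF cont]
    by auto
  \<comment> \<open>The minimum is \<open>6 * \<eta>\<close>; the remainder costs \<open>2 * \<eta>\<close> and the passage to radius \<open>R\<close> another \<open>\<eta>\<close>, which leaves \<open>\<kappa> = 3 * \<eta> > \<epsilon> = 2 * \<eta>\<close>.\<close>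
  define \<eta> where "\<eta> = norm (fps_value F z0) / 6"
  have \<eta>: "0 < \<eta>" using nz[OF z0(1)] by (simp add: \<eta>_def)
  have \<eta>_le: "6 * \<eta> \<le> norm (fps_value F z)" if "norm z \<le> 1" for z :: complex
    using z0(2)[OF that] by (simp add: \<eta>_def)
  obtain n0 where n0: "\<And>n. n \<ge> n0 \<Longrightarrow> norm (\<Sum>i. \<bar>F $ (i + n)\<bar>) < 2 * \<eta>"
    using suminf_exist_split[of "2 * \<eta>" "\<lambda>k. \<bar>F $ k\<bar>"] l1 \<eta> unfolding l1_fps_def by auto
  define m where "m = max n0 1"
  have m: "(\<Sum>i. \<bar>F $ (i + m)\<bar>) < 2 * \<eta>" "0 < m" using n0[of m] by (auto simp: m_def)
  define P where "P = fps_cutoff m F"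
  define h where "h = P - F"
  define \<epsilon> where "\<epsilon> = 2 * \<eta>"
  define \<kappa> where "\<kappa> = 3 * \<eta>"
  have ek: "0 < \<epsilon>" "0 < \<kappa>" "\<epsilon> / \<kappa> = 2 / 3" using \<eta> by (auto simp: \<epsilon>_def \<kappa>_def)
  have h_nth: "h $ k = (if k < m then 0 else - F $ k)" for k by (simp add: h_def P_def)
  have summ_tail: "summable (\<lambda>i. \<bar>F $ (i + m)\<bar>)"
    using l1 unfolding l1_fps_def by (rule summable_ignore_initial_segment)
  have hd: "decays s \<epsilon> C h"
    unfolding decays_def
  proof (intro conjI allI impI)
    fix n
    have "(\<Sum>i\<le>n. \<bar>h $ i\<bar>) = (\<Sum>i\<in>{m..n}. \<bar>F $ i\<bar>)"
      by (rule sum.mono_neutral_cong_right) (auto simp: h_nth)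
    also have "\<dots> \<le> (\<Sum>i\<in>{m..<m + Suc n}. \<bar>F $ i\<bar>)" by (rule sum_mono2) auto
    also have "\<dots> = (\<Sum>i<Suc n. \<bar>F $ (i + m)\<bar>)"
      using sum.shift_bounds_nat_ivl[of "\<lambda>i. \<bar>F $ i\<bar>" 0 m "Suc n"] by (simp add: atLeast0LessThan add.commute)
    also have "\<dots> \<le> (\<Sum>i. \<bar>F $ (i + m)\<bar>)" using summ_tail by (intro sum_le_suminf) auto
    finally show "(\<Sum>i\<le>n. \<bar>h $ i\<bar>) \<le> \<epsilon>" using m(1) by (simp add: \<epsilon>_def)
  next
    fix k :: nat assume "1 \<le> k"
    then show "\<bar>h $ k\<bar> \<le> C * real k powr - s"
      using F decays_nonneg[OF F] by (auto simp: h_nth decays_def)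
  qed
  define p where "p = (\<lambda>z::complex. \<Sum>k<m. of_real (P $ k) * z ^ k)"
  have p_disc: "4 * \<eta> \<le> norm (p z)" if z: "norm z \<le> 1" for z
  proof -
    have "fps_value F z = (\<Sum>i. of_real (F $ (i + m)) * z ^ (i + m)) + p z"
      unfolding fps_value_def p_def P_def
      by (subst suminf_split_initial_segment[where k = m]) (auto intro: l1_summable_value l1 z)
    moreover have "norm (\<Sum>i. of_real (F $ (i + m)) * z ^ (i + m)) \<le> (\<Sum>i. \<bar>F $ (i + m)\<bar>)"
      using summ_tail z by (intro norm_suminf_le norm_of_real_mult_power_le) auto
    ultimately have "norm (fps_value F z) \<le> 2 * \<eta> + norm (p z)"
      using m(1) norm_triangle_ineq[of "\<Sum>i. of_real (F $ (i + m)) * z ^ (i + m)" "p z"] by simp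
    then show ?thesis using \<eta>_le[OF z] by simp
  qed
  have "uniformly_continuous_on (cball 0 2) p"
    unfolding p_def by (intro compact_uniformly_continuous continuous_intros) auto
  then obtain \<rho> where \<rho>: "0 < \<rho>" "\<And>x y. norm x \<le> 2 \<Longrightarrow> norm y \<le> 2 \<Longrightarrow> dist x y < \<rho> \<Longrightarrow> dist (p x) (p y) < \<eta>"
    using \<eta> unfolding uniformly_continuous_on_def by (metis mem_cball_0)
  define R where "R = 1 + min 1 (\<rho> / 2)"
  have R: "1 < R" "R \<le> 2" "R - 1 < \<rho>" using \<rho>(1) by (auto simp: R_def)
  have p_lower: "\<kappa> \<le> norm (p z)" if z: "norm z \<le> R" for z
  proof -
    define w where "w = z / of_real R"
    have w: "norm w \<le> 1" using z R by (simp add: w_def norm_divide)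
    have "z - w = w * of_real (R - 1)" using R by (simp add: w_def field_simps)
    then have "dist z w = norm w * (R - 1)"
      using R by (simp only: dist_norm norm_mult norm_of_real)
    also have "\<dots> \<le> 1 * (R - 1)" using w R by (intro mult_right_mono) auto
    finally have "dist (p z) (p w) < \<eta>" using z w R by (intro \<rho>) auto
    then show ?thesis using p_disc[OF w] norm_triangle_ineq2[of "p w" "p z"]
      by (simp add: \<kappa>_def dist_norm norm_minus_commute)
  qed
  define Q where "Q = inverse P"
  define Y where "Y = (\<Sum>k. (1 / R) ^ k)"
  have sumR: "summable (\<lambda>k. (1 / R) ^ k)" using R by (intro summable_geometric) auto
  have "(\<lambda>k. real k powr s * (1 / R) ^ k) \<longlonglongrightarrow> 0"
    using R by real_asymp
  then have "Bseq (\<lambda>k. real k powr s * (1 / R) ^ k)"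
    by (intro convergent_imp_Bseq convergentI)
  then obtain M where M: "0 < M" "\<And>k. \<bar>real k powr s * (1 / R) ^ k\<bar> \<le> M"
    by (elim BseqE) (auto simp only: real_norm_def)
  have Qd: "decays s ((1 / \<kappa>) ^ n * Y) ((1 / \<kappa>) ^ n * M) (Q ^ n)" for n
  proof -
    have *: "\<bar>(Q ^ n) $ k\<bar> \<le> (1 / \<kappa>) ^ n * (1 / R) ^ k" for k
      unfolding Q_def
    proof (rule inverse_power_coeff_bound)
      show "\<kappa> \<le> norm (\<Sum>k<m. of_real (P $ k) * z ^ k)" if "norm z \<le> R" for z :: complex
        using p_lower[OF that] unfolding p_def .
    qed (use R ek in \<open>auto simp: P_def\<close>)
    show ?thesis unfolding decays_def
    proof (intro conjI allI impI)
      fix l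
      have "(\<Sum>i\<le>l. \<bar>(Q ^ n) $ i\<bar>) \<le> (\<Sum>i\<le>l. (1 / \<kappa>) ^ n * (1 / R) ^ i)" by (intro sum_mono *)
      also have "\<dots> = (1 / \<kappa>) ^ n * (\<Sum>i\<le>l. (1 / R) ^ i)" by (simp add: sum_distrib_left)
      also have "\<dots> \<le> (1 / \<kappa>) ^ n * Y"
        unfolding Y_def using sumR ek R by (intro mult_left_mono sum_le_suminf) auto
      finally show "(\<Sum>i\<le>l. \<bar>(Q ^ n) $ i\<bar>) \<le> (1 / \<kappa>) ^ n * Y" .
    next
      fix k :: nat assume k: "1 \<le> k"
      have "(1 / R) ^ k \<le> M * real k powr - s"
      proof -
        have "real k powr s * (1 / R) ^ k \<le> M" using M(2)[of k] by linarith
        then have "(1 / R) ^ k \<le> M / real k powr s"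
          using k by (subst pos_le_divide_eq) (auto simp only: mult.commute powr_gt_zero)
        then show ?thesis by (simp only: powr_minus divide_inverse)
      qed
      then have "(1 / \<kappa>) ^ n * (1 / R) ^ k \<le> (1 / \<kappa>) ^ n * (M * real k powr - s)"
        using ek by (intro mult_left_mono) auto
      then show "\<bar>(Q ^ n) $ k\<bar> \<le> (1 / \<kappa>) ^ n * M * real k powr - s"
        using *[of k] by simp
    qed
  qed
  have YM: "0 \<le> Y" unfolding Y_def using R sumR by (intro suminf_nonneg) auto
  define NN where "NN = (\<lambda>n. \<epsilon> ^ n * ((1 / \<kappa>) ^ Suc n * Y))"
  define CC where "CC = (\<lambda>n. (1/2) powr (- s) * (C * real n powr (s + 1) * \<epsilon> ^ n / \<epsilon>) * ((1 / \<kappa>) ^ Suc n * Y)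
      + (1 - 1/2) powr (- s) * \<epsilon> ^ n * ((1 / \<kappa>) ^ Suc n * M))"
  have Td: "decays s (NN n) (CC n) (h ^ n * Q ^ Suc n)" for n
    unfolding NN_def CC_def by (intro decays_mult decays_power_all hd s Qd ek) auto
  have pw: "\<epsilon> ^ n * (1 / \<kappa>) ^ Suc n = (1 / \<kappa>) * (2 / 3) ^ n" for n
    unfolding ek(3)[symmetric] by (simp add: power_divide)
  have NN': "NN n = (Y / \<kappa>) * (2 / 3) ^ n" for n
    unfolding NN_def mult.assoc[symmetric] pw by simp
  have CC': "CC n = (1/2) powr (- s) * C / \<epsilon> * Y / \<kappa> * (real n powr (s + 1) * (2 / 3) ^ n)
      + (1/2) powr (- s) * M / \<kappa> * (2 / 3) ^ n" for n
  proof -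
    have "CC n = (1/2) powr (- s) * C / \<epsilon> * Y * real n powr (s + 1) * (\<epsilon> ^ n * (1 / \<kappa>) ^ Suc n)
        + (1/2) powr (- s) * M * (\<epsilon> ^ n * (1 / \<kappa>) ^ Suc n)"
    proof -
      have h: "(1 - 1/2 :: real) = 1/2" by simp
      define e where "e = \<epsilon> ^ n"
      define k where "k = (1 / \<kappa>) ^ Suc n"
      show ?thesis unfolding CC_def h e_def[symmetric] k_def[symmetric] by (simp add: mult_ac)
    qed
    then show ?thesis unfolding pw by (simp add: mult_ac)
  qed
  have NNs: "summable NN" unfolding NN' by (intro summable_mult summable_geometric) auto
  have "summable (\<lambda>n. real n powr (s + 1) * (2 / 3) ^ n)"
  proof (rule summable_comparison_test_bigo)
    show "summable (\<lambda>n. norm ((5 / 6 :: real) ^ n))" by (simp add: summable_geometric)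
    show "(\<lambda>n. real n powr (s + 1) * (2 / 3) ^ n) \<in> O(\<lambda>n. (5 / 6) ^ n)" by real_asymp
  qed
  then have CCs: "summable CC" unfolding CC' by (intro summable_add summable_mult summable_geometric) auto
  have nn: "0 \<le> NN n" "0 \<le> CC n" for n using decays_nonneg[OF Td[of n]] by auto
  have P0: "P $ 0 \<noteq> 0"
  proof -
    have "p 0 = of_real (P $ 0)"
      unfolding p_def using m(2) by (subst sum.mono_neutral_right[of _ "{0}"]) (auto simp: power_0_left)
    then show ?thesis using p_disc[of 0] \<eta> by auto
  qed
  have F0: "F $ 0 \<noteq> 0" using P0 m(2) by (simp add: P_def)
  have PQ: "P * Q = 1" unfolding Q_def using P0 by (rule inverse_mult_eq_1')
  \<comment> \<open>As \<open>h\<close> has no constant term, finitely many terms of the Neumann series give each coefficient exactly.\<close>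
  have series: "inverse F $ k = (\<Sum>n<K. (h ^ n * Q ^ Suc n) $ k)" if "k < K" for k K
  proof -
    have "F * (\<Sum>n<K. h ^ n * Q ^ Suc n) = (1 - h * Q) * (\<Sum>n<K. (h * Q) ^ n)"
    proof -
      have "F * Q = 1 - h * Q" using PQ by (simp add: h_def algebra_simps)
      moreover have "F * (\<Sum>n<K. h ^ n * Q ^ Suc n) = (F * Q) * (\<Sum>n<K. (h * Q) ^ n)"
        by (simp add: sum_distrib_left power_mult_distrib mult_ac)
      ultimately show ?thesis by simp
    qed
    also have "\<dots> = 1 - (h * Q) ^ K" by (rule one_diff_power_eq[symmetric])
    finally have "inverse F * (F * (\<Sum>n<K. h ^ n * Q ^ Suc n)) = inverse F * (1 - (h * Q) ^ K)" by simp
    moreover have "inverse F * (F * G) = G" for G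
      by (simp only: mult.assoc[symmetric] inverse_mult_eq_1[OF F0] mult_1_left)
    moreover have "inverse F * (1 - G) = inverse F - G * inverse F" for G
      by (simp only: right_diff_distrib mult_1_right mult_1_left mult.commute)
    ultimately have "(\<Sum>n<K. h ^ n * Q ^ Suc n) = inverse F - (h * Q) ^ K * inverse F"
      by (simp only:)
    moreover have "((h * Q) ^ K * inverse F) $ k = 0"
    proof -
      have "(h * Q) $ 0 = 0" using m(2) by (simp add: h_nth)
      then have "\<forall>n<K. ((h * Q) ^ K) $ n = 0" by (rule startsby_zero_power_prefix)
      then show ?thesis using that unfolding fps_mult_nth by (intro sum.neutral) auto
    qed
    ultimately have "(\<Sum>n<K. h ^ n * Q ^ Suc n) $ k = inverse F $ k" by simp
    then show ?thesis by (simp add: fps_sum_nth)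
  qed
  have series_le: "\<bar>inverse F $ i\<bar> \<le> (\<Sum>n<Suc k. \<bar>(h ^ n * Q ^ Suc n) $ i\<bar>)" if "i \<le> k" for i k
    unfolding series[of i "Suc k", OF le_imp_less_Suc[OF that]] by (rule sum_abs)
  have "decays s (suminf NN) (suminf CC) (inverse F)"
    unfolding decays_def
  proof (intro conjI allI impI)
    fix k
    have "(\<Sum>i\<le>k. \<bar>inverse F $ i\<bar>) \<le> (\<Sum>i\<le>k. \<Sum>n<Suc k. \<bar>(h ^ n * Q ^ Suc n) $ i\<bar>)"
      by (intro sum_mono series_le) simp
    also have "\<dots> = (\<Sum>n<Suc k. \<Sum>i\<le>k. \<bar>(h ^ n * Q ^ Suc n) $ i\<bar>)" by (rule sum.swap)
    also have "\<dots> \<le> (\<Sum>n<Suc k. NN n)" using Td unfolding decays_def by (intro sum_mono) blast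
    also have "\<dots> \<le> suminf NN" using NNs nn by (intro sum_le_suminf) auto
    finally show "(\<Sum>i\<le>k. \<bar>inverse F $ i\<bar>) \<le> suminf NN" .
  next
    fix k :: nat assume k: "1 \<le> k"
    have "\<bar>inverse F $ k\<bar> \<le> (\<Sum>n<Suc k. \<bar>(h ^ n * Q ^ Suc n) $ k\<bar>)"
      by (rule series_le) simp
    also have "\<dots> \<le> (\<Sum>n<Suc k. CC n * real k powr - s)"
      using Td k unfolding decays_def by (intro sum_mono) blast
    also have "\<dots> = (\<Sum>n<Suc k. CC n) * real k powr - s" by (simp only: sum_distrib_right)
    also have "\<dots> \<le> suminf CC * real k powr - s"
      using CCs nn by (intro mult_right_mono sum_le_suminf) auto
    finally show "\<bar>inverse F $ k\<bar> \<le> suminf CC * real k powr - s" .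
  qed
  then show ?thesis by blast
qed

section \<open>Asymptotics of the coefficients of products and inverses\<close>

lemma cesaro_zero:
  fixes t :: "nat \<Rightarrow> real"
  assumes "t \<longlonglongrightarrow> 0"
  shows "(\<lambda>n. (\<Sum>j\<le>n. \<bar>t j\<bar>) / real n) \<longlonglongrightarrow> 0"
proof (rule LIMSEQ_I)
  fix r :: real assume r: "0 < r"
  obtain J where J: "\<And>j. J \<le> j \<Longrightarrow> \<bar>t j\<bar> < r / 4"
    using LIMSEQ_D[OF assms, of "r / 4"] r by auto
  define A where "A = (\<Sum>j<J. \<bar>t j\<bar>)"
  have A: "0 \<le> A" by (simp add: A_def sum_nonneg)
  obtain n0 :: nat where n0: "2 * A / r < real n0" using reals_Archimedean2 by blast
  show "\<exists>no. \<forall>n\<ge>no. norm ((\<Sum>j\<le>n. \<bar>t j\<bar>) / real n - 0) < r"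
  proof (intro exI allI impI)
    fix n assume n: "max (Suc J) (Suc n0) \<le> n"
    have "(\<Sum>j\<le>n. \<bar>t j\<bar>) = A + (\<Sum>j=J..n. \<bar>t j\<bar>)"
      unfolding A_def using n by (subst sum.union_disjoint[symmetric]) (auto intro!: sum.cong)
    also have "(\<Sum>j=J..n. \<bar>t j\<bar>) \<le> (\<Sum>j=J..n. r / 4)" by (intro sum_mono) (use J in \<open>auto intro: less_imp_le\<close>)
    also have "\<dots> \<le> (real n + 1) * (r / 4)"
      using r by simp
    also have "\<dots> \<le> (2 * real n) * (r / 4)" using n r by (intro mult_right_mono) auto
    finally have "(\<Sum>j\<le>n. \<bar>t j\<bar>) \<le> A + real n * r / 2" by (simp add: mult.commute)
    moreover have "A < real n * r / 2"
    proof -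
      have "2 * A / r < real n" using n0 n by linarith
      then show ?thesis using r by (simp add: divide_less_eq)
    qed
    ultimately have "(\<Sum>j\<le>n. \<bar>t j\<bar>) < r * real n" by (simp add: mult.commute)
    then have "(\<Sum>j\<le>n. \<bar>t j\<bar>) / real n < r" using n by (simp add: divide_less_eq)
    moreover have "0 \<le> (\<Sum>j\<le>n. \<bar>t j\<bar>) / real n" by (simp add: sum_nonneg)
    ultimately show "norm ((\<Sum>j\<le>n. \<bar>t j\<bar>) / real n - 0) < r" by simp
  qed
qed

lemma powr_ratio_limit: "(\<lambda>n. (real n / real (n - k)) powr r) \<longlonglongrightarrow> 1"
proof -
  have "(\<lambda>n. (real n / (real n - real k)) powr r) \<longlonglongrightarrow> 1" by real_asymp
  then show ?thesis
    by (rule Lim_transform_eventually) (auto intro!: eventually_sequentiallyI[of k] simp: of_nat_diff)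
qed

text \<open>In \<open>(X * T) $ n\<close> the terms \<open>X $ k * T $ (n - k)\<close> with \<open>2 * k \<le> n\<close> are dominated by a multiple of
  \<open>|X $ k|\<close> after rescaling, so that Tannery's theorem gives the limit. The remaining ones contribute
  a multiple of the arithmetic mean of \<open>|T $ 0|, ..., |T $ n|\<close>, which vanishes in the limit because
  \<open>T $ n\<close> does. The coefficients of \<open>T\<close> decay only like \<open>n powr (1 - s)\<close>, so \<open>T\<close> need not be summable.\<close>

lemma mult_tail_limit:
  fixes X T :: "real fps"
  assumes X: "decays s N C X" and s: "1 < s"
    and T: "(\<lambda>n. real n powr (s - 1) * T $ n) \<longlonglongrightarrow> l"
  shows "(\<lambda>n. real n powr (s - 1) * (X * T) $ n) \<longlonglongrightarrow> l * fps_value X 1"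
proof -
  define r where "r = s - 1"
  have r: "0 < r" using s by (simp add: r_def)
  have l1: "l1_fps X" using X by (rule decays_l1)
  note T' = T[folded r_def]
  obtain K where K: "0 < K" "\<And>n. \<bar>real n powr r * T $ n\<bar> \<le> K"
    using convergent_imp_Bseq[OF convergentI[OF T']] by (elim BseqE) (auto simp only: real_norm_def)
  define a where "a = (\<lambda>k n. if 2 * k \<le> n then X $ k * (real n powr r * T $ (n - k)) else 0)"
  have lim: "(\<lambda>n. a k n) \<longlonglongrightarrow> X $ k * l" for k
  proof -
    have "(\<lambda>n. real (n - k) powr r * T $ (n - k)) \<longlonglongrightarrow> l"
      using T' by (rule filterlim_compose) (rule filterlim_minus_const_nat_at_top)
    then have "(\<lambda>n. X $ k * ((real n / real (n - k)) powr r * (real (n - k) powr r * T $ (n - k)))) \<longlonglongrightarrow> X $ k * (1 * l)"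
      by (intro tendsto_mult tendsto_const powr_ratio_limit)
    moreover have "eventually (\<lambda>n. X $ k * ((real n / real (n - k)) powr r * (real (n - k) powr r * T $ (n - k))) = a k n) sequentially"
      using eventually_ge_at_top[of "2 * k + 1"]
    proof eventually_elim
      case (elim n)
      then have "(real n / real (n - k)) powr r * real (n - k) powr r = real n powr r"
        by (simp add: powr_divide)
      then show ?case using elim by (simp add: a_def mult.assoc[symmetric])
    qed
    ultimately show ?thesis by (simp add: Lim_transform_eventually)
  qed
  have bound: "norm (a k n) \<le> \<bar>X $ k\<bar> * (2 powr r * K)" for k n
  proof (cases "2 * k \<le> n")
    case True
    have "real n powr r \<le> (2 * real (n - k)) powr r" using True r by (intro powr_mono2) auto
    also have "\<dots> = 2 powr r * real (n - k) powr r" by (simp add: powr_mult)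
    finally have "real n powr r * \<bar>T $ (n - k)\<bar> \<le> 2 powr r * real (n - k) powr r * \<bar>T $ (n - k)\<bar>"
      by (intro mult_right_mono) auto
    also have "\<dots> = 2 powr r * \<bar>real (n - k) powr r * T $ (n - k)\<bar>" by (simp add: abs_mult)
    also have "\<dots> \<le> 2 powr r * K" using K(2) by (intro mult_left_mono) auto
    finally show ?thesis using True by (simp add: a_def abs_mult mult_left_mono)
  qed (use K in \<open>simp add: a_def\<close>)
  have "(\<lambda>n. \<Sum>k. a k n) \<longlonglongrightarrow> (\<Sum>k. X $ k * l)"
  proof -
    have "summable (\<lambda>k. \<bar>X $ k\<bar> * (2 powr r * K))" using l1 unfolding l1_fps_def by (rule summable_mult2)
    then show ?thesis
      using tannerys_theorem[of a "\<lambda>k. X $ k * l" sequentially "\<lambda>k. \<bar>X $ k\<bar> * (2 powr r * K)"] lim bound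
      by (simp add: case_prod_unfold)
  qed
  moreover have "(\<Sum>k. X $ k * l) = l * fps_value X 1"
    using suminf_mult2[of "\<lambda>k. X $ k" l] l1_summable_value(2)[OF l1, of "1::real"]
    by (simp add: fps_value_def mult.commute)
  ultimately have main: "(\<lambda>n. \<Sum>k. a k n) \<longlonglongrightarrow> l * fps_value X 1" by (simp only:)
  have fin: "(\<Sum>k. a k n) = (\<Sum>k\<le>n. a k n)" for n
    by (rule suminf_finite) (auto simp: a_def)
  have "(\<lambda>n. T $ n) \<longlonglongrightarrow> 0"
  proof -
    have "(\<lambda>n. real n powr (- r)) \<longlonglongrightarrow> 0" using r by real_asymp
    then have "(\<lambda>n. real n powr (- r) * (real n powr r * T $ n)) \<longlonglongrightarrow> 0 * l" using T' by (intro tendsto_mult)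
    moreover have "eventually (\<lambda>n. real n powr (- r) * (real n powr r * T $ n) = T $ n) sequentially"
      using eventually_gt_at_top[of 0] by eventually_elim (simp add: powr_minus)
    ultimately show ?thesis by (simp add: Lim_transform_eventually)
  qed
  then have ces: "(\<lambda>n. C * 2 powr s * ((\<Sum>j\<le>n. \<bar>T $ j\<bar>) / real n)) \<longlonglongrightarrow> 0"
    by (intro tendsto_mult_right_zero cesaro_zero)
  have "(\<lambda>n. real n powr r * (X * T) $ n - (\<Sum>k. a k n)) \<longlonglongrightarrow> 0"
  proof (rule Lim_null_comparison[OF _ ces])
    show "eventually (\<lambda>n. norm (real n powr r * (X * T) $ n - (\<Sum>k. a k n))
        \<le> C * 2 powr s * ((\<Sum>j\<le>n. \<bar>T $ j\<bar>) / real n)) sequentially"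
      using eventually_ge_at_top[of 1]
    proof eventually_elim
      case (elim n)
      have C: "0 \<le> C" using decays_nonneg[OF X] by auto
      have "real n powr r * (X * T) $ n - (\<Sum>k. a k n)
          = (\<Sum>k\<le>n. X $ k * (real n powr r * T $ (n - k)) - a k n)"
        unfolding fin fps_mult_nth atLeast0AtMost sum_subtractf sum_distrib_left by (simp add: mult_ac)
      also have "norm \<dots> \<le> (\<Sum>k\<le>n. C * 2 powr s * \<bar>T $ (n - k)\<bar> / real n)"
      proof (rule sum_norm_le)
        fix k assume k: "k \<in> {..n}"
        show "norm (X $ k * (real n powr r * T $ (n - k)) - a k n) \<le> C * 2 powr s * \<bar>T $ (n - k)\<bar> / real n"
        proof (cases "2 * k \<le> n")
          case True then show ?thesis using C by (simp add: a_def)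
        next
          case False
          then have k1: "1 \<le> k" by auto
          have "\<bar>X $ k\<bar> \<le> C * real k powr - s" using X k1 by (auto simp: decays_def)
          moreover have "real k powr - s \<le> (real n / 2) powr - s"
            using False elim s by (intro powr_mono2') auto
          moreover have "(real n / 2) powr - s = 2 powr s * real n powr - s"
          proof -
            have "(real n / 2) powr - s = real n powr - s / 2 powr - s" by (rule powr_divide)
            then show ?thesis by (simp only: powr_minus[of 2 s] divide_inverse inverse_inverse_eq mult.commute)
          qed
          ultimately have "\<bar>X $ k\<bar> \<le> C * (2 powr s * real n powr - s)"
            using C by (metis mult_left_mono order_trans)
          then have "\<bar>X $ k\<bar> * (real n powr r * \<bar>T $ (n - k)\<bar>)
              \<le> C * (2 powr s * real n powr - s) * (real n powr r * \<bar>T $ (n - k)\<bar>)"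
            by (intro mult_right_mono) auto
          also have "\<dots> = C * 2 powr s * \<bar>T $ (n - k)\<bar> * (real n powr - s * real n powr r)"
            by (simp only: mult_ac)
          also have "real n powr - s * real n powr r = 1 / real n"
            using elim unfolding powr_add[symmetric] by (simp add: r_def powr_neg_one)
          finally show ?thesis using False by (simp add: a_def abs_mult)
        qed
      qed
      also have "\<dots> = C * 2 powr s * ((\<Sum>k\<le>n. \<bar>T $ (n - k)\<bar>) / real n)"
        by (simp add: sum_distrib_left sum_divide_distrib)
      also have "(\<Sum>i\<le>n. \<bar>T $ (n - i)\<bar>) = (\<Sum>i\<le>n. \<bar>T $ i\<bar>)"
        by (rule sum.nat_diff_reindex[of "\<lambda>i. \<bar>T $ i\<bar>" "Suc n", unfolded lessThan_Suc_atMost, simplified])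
      finally show ?case .
    qed
  qed
  from tendsto_add[OF this main] show ?thesis by (simp add: r_def)
qed

definition has_tail :: "real \<Rightarrow> real fps \<Rightarrow> real \<Rightarrow> bool" where
  "has_tail s F l \<longleftrightarrow> (\<lambda>n. real n powr s * F $ n) \<longlonglongrightarrow> l"

lemma has_tail_decays:
  assumes "has_tail s F l" "1 < s"
  shows "\<exists>N C. decays s N C F"
proof -
  obtain K where K: "0 < K" "\<And>n. \<bar>real n powr s * F $ n\<bar> \<le> K"
    using convergent_imp_Bseq[OF convergentI[OF assms(1)[unfolded has_tail_def]]]
    by (elim BseqE) (auto simp only: real_norm_def)
  have le: "\<bar>F $ k\<bar> \<le> K * real k powr - s" if "1 \<le> k" for k
  proof -
    have "real k powr s * \<bar>F $ k\<bar> \<le> K" using K(2)[of k] by (simp add: abs_mult)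
    then have "\<bar>F $ k\<bar> \<le> K / real k powr s"
      using that by (subst pos_le_divide_eq) (auto simp add: mult.commute)
    then show ?thesis by (simp only: powr_minus divide_inverse)
  qed
  have "summable (\<lambda>k. K * real k powr - s)"
    using assms(2) by (intro summable_mult) (simp add: summable_real_powr_iff)
  then have "l1_fps F" unfolding l1_fps_def
    by (rule summable_comparison_test'[of _ 1]) (use le in auto)
  then show ?thesis using le l1_sum_le[of F] unfolding decays_def by blast
qed

lemma has_tail_l1: "has_tail s F l \<Longrightarrow> 1 < s \<Longrightarrow> l1_fps F"
  using has_tail_decays decays_l1 by blast

text \<open>Passing to \<open>X F'\<close> multiplies the \<open>n\<close>-th coefficient by \<open>n\<close>. In this form the Leibniz rule reduces
  products and inverses to \<open>mult_tail_limit\<close>, where only one factor needs exact asymptotics.\<close>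

lemma has_tail_XD:
  "has_tail s F l \<longleftrightarrow> (\<lambda>n. real n powr (s - 1) * (fps_X * fps_deriv F) $ n) \<longlonglongrightarrow> l"
proof -
  have "real n powr (s - 1) * (fps_X * fps_deriv F) $ n = real n powr s * F $ n" for n
    by (cases n) (simp_all add: powr_diff)
  then show ?thesis by (simp only: has_tail_def)
qed

lemma has_tail_mult:
  assumes F: "has_tail s F l" and G: "has_tail s G m" and s: "1 < s"
  shows "has_tail s (F * G) (m * fps_value F 1 + l * fps_value G 1)"
proof -
  obtain N C N' C' where FG: "decays s N C F" "decays s N' C' G"
    using has_tail_decays F G s by blast
  have "(\<lambda>n. real n powr (s - 1) * (F * (fps_X * fps_deriv G)) $ n) \<longlonglongrightarrow> m * fps_value F 1"
    by (rule mult_tail_limit[OF FG(1) s G[unfolded has_tail_XD]])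
  moreover have "(\<lambda>n. real n powr (s - 1) * (G * (fps_X * fps_deriv F)) $ n) \<longlonglongrightarrow> l * fps_value G 1"
    by (rule mult_tail_limit[OF FG(2) s F[unfolded has_tail_XD]])
  ultimately have lim: "(\<lambda>n. real n powr (s - 1) * (F * (fps_X * fps_deriv G)) $ n
      + real n powr (s - 1) * (G * (fps_X * fps_deriv F)) $ n) \<longlonglongrightarrow> m * fps_value F 1 + l * fps_value G 1"
    by (rule tendsto_add)
  have deriv: "fps_X * fps_deriv (F * G) = F * (fps_X * fps_deriv G) + G * (fps_X * fps_deriv F)"
    unfolding fps_deriv_mult distrib_left
    by (intro arg_cong2[of _ _ _ _ "(+)"] mult.left_commute) (metis mult.commute mult.left_commute)
  show ?thesis unfolding has_tail_XD deriv fps_add_nth distrib_left by (rule lim)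
qed

lemma has_tail_inverse:
  assumes F: "has_tail s F l" and s: "1 < s"
    and nz: "\<And>z::complex. norm z \<le> 1 \<Longrightarrow> fps_value F z \<noteq> 0"
  shows "has_tail s (inverse F) (- l * (fps_value (inverse F) 1)\<^sup>2)"
proof -
  obtain N C where "decays s N C F" using has_tail_decays F s by blast
  then obtain N' C' where G: "decays s N' C' (inverse F)"
    using inverse_decays[of s N C F] s nz by auto
  have l1: "l1_fps (inverse F)" using G by (rule decays_l1)
  have F0: "F $ 0 \<noteq> 0" using nz[of 0] by (auto simp: fps_value_def)
  have s0: "0 \<le> s" using s by simp
  have "decays s (N' * N') ((1/2) powr - s * C' * N' + (1 - 1/2) powr - s * N' * C') (inverse F * inverse F)"
    using G G s0 by (rule decays_mult) auto
  then have "(\<lambda>n. real n powr (s - 1) * ((inverse F * inverse F) * (fps_X * fps_deriv F)) $ n)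
      \<longlonglongrightarrow> l * fps_value (inverse F * inverse F) 1"
    using F s unfolding has_tail_XD by (intro mult_tail_limit)
  moreover have "fps_X * fps_deriv (inverse F) = - ((inverse F * inverse F) * (fps_X * fps_deriv F))"
    unfolding fps_inverse_deriv[OF F0] power2_eq_square by (simp only: mult_minus_left mult_minus_right mult_ac)
  moreover have "fps_value (inverse F * inverse F) 1 = (fps_value (inverse F) (1::real))\<^sup>2"
    unfolding power2_eq_square by (rule fps_value_mult[OF l1 l1]) simp
  ultimately have lim: "(\<lambda>n. - (real n powr (s - 1) * (- (fps_X * fps_deriv (inverse F))) $ n))
      \<longlonglongrightarrow> - (l * (fps_value (inverse F) 1)\<^sup>2)"
    by (intro tendsto_minus) (simp only: minus_minus)
  have "- (real n powr (s - 1) * (- G) $ n) = real n powr (s - 1) * G $ n" for n and G :: "real fps"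
    by simp
  then show ?thesis unfolding has_tail_XD
    using lim by (simp only: mult_minus_left)
qed

lemma has_tail_add: "has_tail s F l \<Longrightarrow> has_tail s G m \<Longrightarrow> has_tail s (F + G) (l + m)"
  unfolding has_tail_def by (simp only: fps_add_nth distrib_left tendsto_add)

lemma has_tail_diff: "has_tail s F l \<Longrightarrow> has_tail s G m \<Longrightarrow> has_tail s (F - G) (l - m)"
  unfolding has_tail_def by (simp only: fps_sub_nth right_diff_distrib tendsto_diff)

lemma has_tail_1: "has_tail s 1 0"
  unfolding has_tail_def
proof (rule tendsto_eventually)
  show "\<forall>\<^sub>F n in sequentially. real n powr s * 1 $ n = 0"
    using eventually_ge_at_top[of 2] by eventually_elim (simp add: fps_one_nth)
qed

lemma has_tail_X: "has_tail s fps_X 0"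
  unfolding has_tail_def
proof (rule tendsto_eventually)
  show "\<forall>\<^sub>F n in sequentially. real n powr s * fps_X $ n = 0"
    using eventually_ge_at_top[of 2] by eventually_elim (simp add: fps_X_nth)
qed

section \<open>Tails of convergent series\<close>

lemma infsum_atLeast_nat:
  fixes f :: "nat \<Rightarrow> real"
  assumes "summable (\<lambda>k. f (k + a))" "\<And>k. a \<le> k \<Longrightarrow> 0 \<le> f k"
  shows "(\<Sum>\<^sub>\<infinity>k\<in>{a..}. f k) = (\<Sum>k. f (k + a))"
proof -
  have "((\<lambda>k. f (k + a)) has_sum (\<Sum>k. f (k + a))) UNIV"
    using assms by (intro sums_nonneg_imp_has_sum summable_sums) auto
  then have "(f has_sum (\<Sum>k. f (k + a))) (range (\<lambda>k. k + a))"
    by (subst has_sum_reindex) (auto simp: inj_on_def o_def)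
  moreover have "range (\<lambda>k. k + a) = {a..}"
    by (auto simp: image_iff) (metis le_add_diff_inverse2)
  ultimately show ?thesis by (simp add: infsumI)
qed

lemma powr_tail_summable: "1 < s \<Longrightarrow> summable (\<lambda>k. real (k + n) powr - s)"
  by (rule summable_ignore_initial_segment) (simp add: summable_real_powr_iff)

lemma powr_step_bounds:
  assumes s: "1 < s" and j: "1 \<le> j"
  shows "(s - 1) * real (Suc j) powr - s \<le> real j powr (1 - s) - real (Suc j) powr (1 - s)"
    and "real j powr (1 - s) - real (Suc j) powr (1 - s) \<le> (s - 1) * real j powr - s"
proof -
  have "\<exists>z>real j. z < real (Suc j) \<and>
      real (Suc j) powr (1 - s) - real j powr (1 - s) = (real (Suc j) - real j) * ((1 - s) * z powr - s)"
  proof (rule MVT2)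
    fix x assume "real j \<le> x"
    then show "((\<lambda>x. x powr (1 - s)) has_real_derivative (1 - s) * x powr - s) (at x)"
      using j by (auto intro!: derivative_eq_intros)
  qed simp
  then obtain z where z: "real j < z" "z < real (Suc j)"
    "real j powr (1 - s) - real (Suc j) powr (1 - s) = (s - 1) * z powr - s"
    by (auto simp: algebra_simps)
  have "real (Suc j) powr - s \<le> z powr - s" "z powr - s \<le> real j powr - s"
    using z(1,2) j s by (auto intro!: powr_mono2')
  then show "(s - 1) * real (Suc j) powr - s \<le> real j powr (1 - s) - real (Suc j) powr (1 - s)"
    and "real j powr (1 - s) - real (Suc j) powr (1 - s) \<le> (s - 1) * real j powr - s"
    using z(3) s by auto
qed

lemma powr_tail_bounds:
  assumes s: "1 < s" and n: "1 \<le> n"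
  shows "(\<Sum>k. real (k + Suc n) powr - s) \<le> real n powr (1 - s) / (s - 1)"
    and "real (Suc n) powr (1 - s) / (s - 1) \<le> (\<Sum>k. real (k + Suc n) powr - s)"
proof -
  have tel: "(\<lambda>k. real (k + m) powr (1 - s) - real (Suc k + m) powr (1 - s)) sums (real (0 + m) powr (1 - s) - 0)" for m
  proof (rule telescope_sums')
    show "(\<lambda>k. real (k + m) powr (1 - s)) \<longlonglongrightarrow> 0" using s by real_asymp
  qed
  have "(\<Sum>k. (s - 1) * real (k + Suc n) powr - s) \<le> (\<Sum>k. real (k + n) powr (1 - s) - real (Suc k + n) powr (1 - s))"
  proof (rule suminf_le)
    show "summable (\<lambda>k. (s - 1) * real (k + Suc n) powr - s)"
      using s by (intro summable_mult powr_tail_summable)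
    show "(s - 1) * real (k + Suc n) powr - s \<le> real (k + n) powr (1 - s) - real (Suc k + n) powr (1 - s)" for k
      using powr_step_bounds(1)[OF s, of "k + n"] n by simp
  qed (rule sums_summable[OF tel])
  also have "\<dots> = real n powr (1 - s)" using sums_unique[OF tel, of n] by simp
  finally have "(s - 1) * (\<Sum>k. real (k + Suc n) powr - s) \<le> real n powr (1 - s)"
    by (subst suminf_mult[symmetric]) (intro powr_tail_summable s)
  then show "(\<Sum>k. real (k + Suc n) powr - s) \<le> real n powr (1 - s) / (s - 1)"
    using s by (simp add: pos_le_divide_eq mult.commute)
  have "real (Suc n) powr (1 - s) = (\<Sum>k. real (k + Suc n) powr (1 - s) - real (Suc k + Suc n) powr (1 - s))"
    using sums_unique[OF tel, of "Suc n"] by simp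
  also have "\<dots> \<le> (\<Sum>k. (s - 1) * real (k + Suc n) powr - s)"
  proof (rule suminf_le)
    show "summable (\<lambda>k. (s - 1) * real (k + Suc n) powr - s)"
      using s by (intro summable_mult powr_tail_summable)
    show "real (k + Suc n) powr (1 - s) - real (Suc k + Suc n) powr (1 - s) \<le> (s - 1) * real (k + Suc n) powr - s" for k
      using powr_step_bounds(2)[OF s, of "k + Suc n"] n by simp
  qed (rule sums_summable[OF tel])
  also have "\<dots> = (s - 1) * (\<Sum>k. real (k + Suc n) powr - s)"
    by (rule suminf_mult) (intro powr_tail_summable s)
  finally show "real (Suc n) powr (1 - s) / (s - 1) \<le> (\<Sum>k. real (k + Suc n) powr - s)"
    using s by (simp add: pos_divide_le_eq mult.commute)
qed

lemma powr_tail_limit: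
  assumes s: "1 < s"
  shows "(\<lambda>n. real n powr (s - 1) * (\<Sum>k. real (k + Suc n) powr - s)) \<longlonglongrightarrow> 1 / (s - 1)"
proof (rule tendsto_sandwich)
  show "eventually (\<lambda>n. real n powr (s - 1) * (real (Suc n) powr (1 - s) / (s - 1))
      \<le> real n powr (s - 1) * (\<Sum>k. real (k + Suc n) powr - s)) sequentially"
    using eventually_ge_at_top[of 1]
    by eventually_elim (intro mult_left_mono powr_tail_bounds s, auto)
  show "eventually (\<lambda>n. real n powr (s - 1) * (\<Sum>k. real (k + Suc n) powr - s) \<le> 1 / (s - 1)) sequentially"
    using eventually_ge_at_top[of 1]
  proof eventually_elim
    case (elim n)
    have "real n powr (s - 1) * (\<Sum>k. real (k + Suc n) powr - s) \<le> real n powr (s - 1) * (real n powr (1 - s) / (s - 1))"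
      using elim by (intro mult_left_mono powr_tail_bounds s) auto
    also have "\<dots> = 1 / (s - 1)" using elim by (simp add: powr_add[symmetric])
    finally show ?case .
  qed
  show "(\<lambda>n. real n powr (s - 1) * (real (Suc n) powr (1 - s) / (s - 1))) \<longlonglongrightarrow> 1 / (s - 1)"
  proof -
    have "(\<lambda>n. (real n / real (Suc n)) powr (s - 1) / (s - 1)) \<longlonglongrightarrow> 1 powr (s - 1) / (s - 1)"
      using s by (intro tendsto_intros LIMSEQ_n_over_Suc_n) auto
    moreover have "(real n / real (Suc n)) powr (s - 1) / (s - 1)
        = real n powr (s - 1) * (real (Suc n) powr (1 - s) / (s - 1))" for n
      unfolding powr_divide using powr_minus[of "real (Suc n)" "s - 1"] by (simp add: divide_inverse)
    ultimately show ?thesis by (simp only: powr_one_eq_one)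
  qed
qed (rule tendsto_const)

text \<open>By comparison with \<open>L * n powr - s\<close>, whose tails are squeezed between telescoping sums.\<close>

lemma tail_sum_limit:
  fixes v :: "nat \<Rightarrow> real"
  assumes s: "1 < s" and v: "(\<lambda>n. real n powr s * v n) \<longlonglongrightarrow> L" and sv: "summable v"
  shows "(\<lambda>n. real n powr (s - 1) * (\<Sum>k. v (k + Suc n))) \<longlonglongrightarrow> L / (s - 1)"
proof -
  define T where "T = (\<lambda>n. \<Sum>k. real (k + Suc n) powr - s)"
  have T: "(\<lambda>n. real n powr (s - 1) * T n) \<longlonglongrightarrow> 1 / (s - 1)"
    unfolding T_def by (rule powr_tail_limit[OF s])
  have sT: "summable (\<lambda>k. real (k + Suc n) powr - s)" for n by (rule powr_tail_summable[OF s])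
  have sv': "summable (\<lambda>k. v (k + Suc n))" for n by (rule summable_ignore_initial_segment[OF sv])
  have "(\<lambda>n. real n powr (s - 1) * (\<Sum>k. v (k + Suc n)) - L * (real n powr (s - 1) * T n)) \<longlonglongrightarrow> 0"
  proof (rule LIMSEQ_I)
    fix r :: real assume r: "0 < r"
    define e where "e = r / 2 * (s - 1)"
    have e: "0 < e" using r s by (simp add: e_def)
    obtain N where N: "\<And>n. N \<le> n \<Longrightarrow> \<bar>real n powr s * v n - L\<bar> < e"
      using LIMSEQ_D[OF v e] by auto
    show "\<exists>no. \<forall>n\<ge>no. norm (real n powr (s - 1) * (\<Sum>k. v (k + Suc n)) - L * (real n powr (s - 1) * T n) - 0) < r"
    proof (intro exI allI impI)
      fix n assume n: "max N 1 \<le> n"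
      have diff: "\<bar>v j - L * real j powr - s\<bar> \<le> e * real j powr - s" if "N \<le> j" "1 \<le> j" for j
      proof -
        have "v j - L * real j powr - s = (real j powr s * v j - L) * real j powr - s"
          using that(2) by (simp add: powr_minus algebra_simps)
        then have "\<bar>v j - L * real j powr - s\<bar> = \<bar>real j powr s * v j - L\<bar> * real j powr - s"
          by (simp add: abs_mult)
        also have "\<dots> \<le> e * real j powr - s" using N[OF that(1)] by (intro mult_right_mono) auto
        finally show ?thesis .
      qed
      have "(\<Sum>k. v (k + Suc n)) - L * T n = (\<Sum>k. v (k + Suc n) - L * real (k + Suc n) powr - s)"
        unfolding T_def using suminf_diff[OF sv' summable_mult[OF sT]] suminf_mult[OF sT] by metis
      also have "\<bar>\<dots>\<bar> \<le> (\<Sum>k. e * real (k + Suc n) powr - s)"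
        unfolding real_norm_def[symmetric]
        using n by (intro norm_suminf_le summable_mult sT, unfold real_norm_def, intro diff) auto
      also have "\<dots> = e * T n" unfolding T_def by (rule suminf_mult[OF sT])
      also have "\<dots> \<le> e * (real n powr (1 - s) / (s - 1))"
        unfolding T_def using e n s by (intro mult_left_mono powr_tail_bounds) auto
      finally have "real n powr (s - 1) * \<bar>(\<Sum>k. v (k + Suc n)) - L * T n\<bar>
          \<le> real n powr (s - 1) * (e * (real n powr (1 - s) / (s - 1)))" by (intro mult_left_mono) auto
      also have "\<dots> = (real n powr (s - 1) * real n powr (1 - s)) * (e / (s - 1))" by simp
      also have "real n powr (s - 1) * real n powr (1 - s) = 1" using n by (simp add: powr_add[symmetric])
      also have "e / (s - 1) = r / 2" unfolding e_def using s by (intro nonzero_mult_div_cancel_right) simp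
      also have "1 * (r / 2) < r" using r by simp
      finally have "\<bar>real n powr (s - 1) * ((\<Sum>k. v (k + Suc n)) - L * T n)\<bar> < r" by (simp add: abs_mult)
      then show "norm (real n powr (s - 1) * (\<Sum>k. v (k + Suc n)) - L * (real n powr (s - 1) * T n) - 0) < r"
        by (simp add: right_diff_distrib mult.left_commute)
    qed
  qed
  from tendsto_add[OF this tendsto_mult_left[OF T, of L]] show ?thesis by simp
qed

section \<open>Power-law block lengths\<close>

text \<open>The law of the length of a block.\<close>

definition block_fps :: "real \<Rightarrow> real fps" where
  "block_fps s = Abs_fps (\<lambda>k. if k = 0 then 0 else real k powr - s / zeta s)"

text \<open>The probabilities that a block is longer than \<open>n\<close>.\<close>

definition survival_fps :: "real \<Rightarrow> real fps" where
  "survival_fps s = Abs_fps (\<lambda>n. \<Sum>k. block_fps s $ (k + Suc n))"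

context
  fixes s :: real
  assumes s: "1 < s"
begin

lemma zeta_eq_suminf: "zeta s = (\<Sum>k. real (k + 1) powr - s)"
  unfolding zeta_def by (rule infsum_atLeast_nat[OF powr_tail_summable[OF s]]) simp

lemma zeta_pos: "0 < zeta s"
proof -
  have "0 < (\<Sum>k. real (k + 1) powr - s)"
    using powr_tail_summable[OF s, of 1] by (intro suminf_pos) auto
  then show ?thesis by (simp only: zeta_eq_suminf)
qed

lemma block_nonneg: "0 \<le> block_fps s $ k"
  using zeta_pos by (simp add: block_fps_def)

lemma block_pos: "1 \<le> k \<Longrightarrow> 0 < block_fps s $ k"
  using zeta_pos by (simp add: block_fps_def)

lemma block_0 [simp]: "block_fps s $ 0 = 0"
  by (simp add: block_fps_def)

lemma block_Suc: "block_fps s $ (k + Suc n) = real (k + Suc n) powr - s / zeta s"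
  by (simp add: block_fps_def)

lemma block_tail_summable: "summable (\<lambda>k. block_fps s $ (k + Suc n))"
  unfolding block_Suc by (intro summable_divide powr_tail_summable s)

lemma block_summable: "summable (\<lambda>k. block_fps s $ k)"
  using block_tail_summable[of 0] summable_iff_shift[of "\<lambda>k. block_fps s $ k" "Suc 0"] by blast

lemma survival_nth: "survival_fps s $ n = (\<Sum>k. real (k + Suc n) powr - s) / zeta s"
proof -
  have "survival_fps s $ n = (\<Sum>k. real (k + Suc n) powr - s / zeta s)"
    by (simp only: survival_fps_def fps_nth_Abs_fps block_Suc)
  then show ?thesis by (simp only: suminf_divide[OF powr_tail_summable[OF s]])
qed

lemma survival_0: "survival_fps s $ 0 = 1"
  using zeta_pos zeta_eq_suminf by (simp add: survival_nth)

lemma survival_Suc: "survival_fps s $ n = block_fps s $ (Suc n) + survival_fps s $ (Suc n)"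
  using suminf_split_head[OF block_tail_summable[of n]]
  by (simp add: survival_fps_def)

lemma block_eq: "block_fps s = 1 - (1 - fps_X) * survival_fps s"
proof (rule fps_ext)
  fix n
  have "(1 - fps_X) * survival_fps s = survival_fps s - fps_X * survival_fps s"
    by (simp only: left_diff_distrib mult_1_left)
  then show "block_fps s $ n = (1 - (1 - fps_X) * survival_fps s) $ n"
    using survival_0 survival_Suc[of "n - 1"] by (cases n) auto
qed

lemma survival_nonneg: "0 \<le> survival_fps s $ n"
  unfolding survival_fps_def using block_nonneg block_tail_summable by (auto intro!: suminf_nonneg)

lemma survival_tail: "has_tail (s - 1) (survival_fps s) (1 / ((s - 1) * zeta s))"
proof -
  have "(\<lambda>n. real n powr (s - 1) * (\<Sum>k. real (k + Suc n) powr - s) / zeta s) \<longlonglongrightarrow> 1 / (s - 1) / zeta s"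
    using powr_tail_limit[OF s] zeta_pos by (intro tendsto_divide tendsto_const) auto
  then show ?thesis by (simp add: has_tail_def survival_nth)
qed

lemma survival_tail_less:
  assumes "r < s"
  shows "has_tail (r - 1) (survival_fps s) 0"
  unfolding has_tail_def
proof -
  have "(\<lambda>n. real n powr (r - s)) \<longlonglongrightarrow> 0" using assms by real_asymp
  then have "(\<lambda>n. real n powr (r - s) * (real n powr (s - 1) * survival_fps s $ n)) \<longlonglongrightarrow> 0 * (1 / ((s - 1) * zeta s))"
    using survival_tail unfolding has_tail_def by (intro tendsto_mult)
  moreover have "real n powr (r - s) * (real n powr (s - 1) * survival_fps s $ n) = real n powr (r - 1) * survival_fps s $ n" for n
    by (simp add: powr_add[symmetric] mult.assoc[symmetric])
  ultimately show "(\<lambda>n. real n powr (r - 1) * survival_fps s $ n) \<longlonglongrightarrow> 0" by simp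
qed

lemma block_l1: "l1_fps (block_fps s)"
  using block_summable block_nonneg by (simp add: l1_fps_def)

text \<open>The triangle inequality for the power series is strict away from \<open>1\<close> already in its terms of degrees
  \<open>1\<close> and \<open>2\<close>: both coefficients are positive, and \<open>b\<^sub>1 + b\<^sub>2 z\<close> attains the modulus
  \<open>b\<^sub>1 + b\<^sub>2\<close> on the closed unit disc at \<open>z = 1\<close> only.\<close>

lemma block_norm_le:
  fixes z :: complex
  assumes z: "norm z \<le> 1"
  shows "norm (fps_value (block_fps s) z) \<le> 1"
    and "z \<noteq> 1 \<Longrightarrow> norm (fps_value (block_fps s) z) < 1"
proof -
  define b where "b = (\<lambda>k. block_fps s $ k)"
  have b: "0 \<le> b k" for k by (simp add: b_def block_nonneg)
  have b12: "0 < b 1" "0 < b 2" by (auto simp: b_def block_pos)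
  have sb: "summable (\<lambda>k. b (k + 3))" unfolding b_def
    by (rule summable_ignore_initial_segment[OF block_summable])
  have b0: "b 0 = 0" by (simp add: b_def)
  have total: "(\<Sum>k. b (k + 3)) + (b 1 + b 2) = 1"
  proof -
    have "(\<Sum>k. b k) = (\<Sum>k. b (k + 3)) + (\<Sum>k<3. b k)"
      unfolding b_def by (rule suminf_split_initial_segment[OF block_summable])
    moreover have "(\<Sum>k. b k) = 1"
      using survival_0 suminf_split_head[OF block_summable] b0 unfolding b_def by (simp add: survival_fps_def)
    ultimately show ?thesis using b0 by (simp add: eval_nat_numeral)
  qed
  have split: "fps_value (block_fps s) z = (\<Sum>k. of_real (b (k + 3)) * z ^ (k + 3)) + (of_real (b 1) * z + of_real (b 2) * z ^ 2)"
  proof -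
    have "fps_value (block_fps s) z = (\<Sum>k. of_real (b (k + 3)) * z ^ (k + 3)) + (\<Sum>k<3. of_real (b k) * z ^ k)"
      unfolding fps_value_def b_def
      by (rule suminf_split_initial_segment[OF l1_summable_value(2)[OF block_l1 z]])
    then show ?thesis using b0 by (simp add: eval_nat_numeral)
  qed
  have tail: "norm (\<Sum>k. of_real (b (k + 3)) * z ^ (k + 3)) \<le> (\<Sum>k. b (k + 3))"
    using z b sb by (intro norm_suminf_le order_trans[OF norm_of_real_mult_power_le]) auto
  have head: "norm (of_real (b 1) * z + of_real (b 2) * z ^ 2) = norm z * norm (of_real (b 1) + of_real (b 2) * z)"
    by (simp add: norm_mult[symmetric] algebra_simps power2_eq_square)
  define q where "q = norm z * norm (of_real (b 1) + of_real (b 2) * z)"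
  have le: "norm (fps_value (block_fps s) z) \<le> (\<Sum>k. b (k + 3)) + q"
    unfolding split q_def head[symmetric] by (rule order_trans[OF norm_triangle_ineq add_right_mono[OF tail]])
  have tri: "norm (of_real (b 1) + of_real (b 2) * z) \<le> b 1 + b 2 * norm z"
    using norm_triangle_ineq[of "of_real (b 1) :: complex" "of_real (b 2) * z"] b by (simp add: norm_mult)
  have bz: "b 2 * norm z \<le> b 2" using z b[of 2] by (simp add: mult_left_le)
  have "norm z * norm (of_real (b 1) + of_real (b 2) * z) \<le> 1 * (b 1 + b 2)"
    using z tri bz by (intro mult_mono) auto
  then have "(\<Sum>k. b (k + 3)) + q \<le> (\<Sum>k. b (k + 3)) + (b 1 + b 2)"
    unfolding q_def by (simp only: mult_1_left add_left_mono)
  then show "norm (fps_value (block_fps s) z) \<le> 1"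
    unfolding total by (rule order_trans[OF le])
  assume z1: "z \<noteq> 1"
  have "norm z * norm (of_real (b 1) + of_real (b 2) * z) < b 1 + b 2"
  proof (cases "norm z < 1")
    case True
    have "norm z * norm (of_real (b 1) + of_real (b 2) * z) \<le> norm z * (b 1 + b 2)"
      using tri bz by (intro mult_left_mono) auto
    also have "\<dots> < 1 * (b 1 + b 2)" using True b12 by (intro mult_strict_right_mono) auto
    finally show ?thesis by simp
  next
    case False
    with z have nz: "norm z = 1" by simp
    have Re: "Re z < 1"
    proof (rule ccontr)
      assume "\<not> Re z < 1"
      moreover have "(Re z)\<^sup>2 + (Im z)\<^sup>2 = 1" using nz by (simp add: cmod_def)
      moreover have "Re z \<le> 1" using complex_Re_le_cmod[of z] nz by simp
      ultimately have "Re z = 1" "Im z = 0" by auto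
      then show False using z1 by (simp add: complex_eq_iff)
    qed
    have "(norm (of_real (b 1) + of_real (b 2) * z))\<^sup>2 = (b 1 + b 2 * Re z)\<^sup>2 + (b 2 * Im z)\<^sup>2"
      by (simp add: cmod_power2)
    also have "\<dots> = (b 1)\<^sup>2 + 2 * (b 1 * b 2) * Re z + (b 2)\<^sup>2 * ((Re z)\<^sup>2 + (Im z)\<^sup>2)"
      by (simp add: power2_eq_square algebra_simps)
    also have "(Re z)\<^sup>2 + (Im z)\<^sup>2 = 1" using nz by (simp add: cmod_def)
    also have "(b 1)\<^sup>2 + 2 * (b 1 * b 2) * Re z + (b 2)\<^sup>2 * 1 < (b 1)\<^sup>2 + 2 * (b 1 * b 2) * 1 + (b 2)\<^sup>2 * 1"
      using Re b12 by (intro add_strict_right_mono add_strict_left_mono mult_strict_left_mono) auto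
    also have "\<dots> = (b 1 + b 2)\<^sup>2" by (simp add: power2_eq_square algebra_simps)
    finally have "norm (of_real (b 1) + of_real (b 2) * z) < b 1 + b 2"
      by (rule power2_less_imp_less) (use b12 in auto)
    then show ?thesis using nz by simp
  qed
  then have "(\<Sum>k. b (k + 3)) + q < (\<Sum>k. b (k + 3)) + (b 1 + b 2)"
    unfolding q_def by (rule add_strict_left_mono)
  then show "norm (fps_value (block_fps s) z) < 1"
    unfolding total by (rule order_le_less_trans[OF le])
qed

end

lemma survival_l1: "2 < s \<Longrightarrow> l1_fps (survival_fps s)"
  using has_tail_l1[OF survival_tail, of s] by simp

lemma survival_value_ge_1:
  assumes "2 < s"
  shows "1 \<le> fps_value (survival_fps s) (1::real)"
proof -
  have "(\<Sum>k<1. survival_fps s $ k) \<le> (\<Sum>k. survival_fps s $ k)"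
    using survival_l1[OF assms] survival_nonneg[of s] assms
    by (intro sum_le_suminf) (auto simp: l1_fps_def)
  then show ?thesis using survival_0[of s] assms by (simp add: fps_value_def)
qed

section \<open>Asymptotics of the alternating renewal process\<close>

text \<open>The generating function of \<open>P(\<tau> > n)\<close>, where \<open>\<tau>\<close> is the length of a block of zeros
  followed by an independent block of ones: \<open>(1 - X) * cycle_fps\<close> is one minus the product of the two
  block generating functions.\<close>

definition cycle_fps :: "real \<Rightarrow> real \<Rightarrow> real fps" where
  "cycle_fps \<gamma> \<delta> = survival_fps \<gamma> + survival_fps \<delta> - (1 - fps_X) * (survival_fps \<gamma> * survival_fps \<delta>)"

text \<open>Division by \<open>D = cycle_fps \<gamma> \<delta>\<close> turns the hypothesis into \<open>(1 - X) K = c - V\<close> with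
  \<open>V = X A B / D\<close>, and the constant \<open>c\<close> equals \<open>V(1)\<close>. Therefore the coefficients of \<open>K\<close> are the tails
  of the series of the coefficients of \<open>V\<close>. The coefficients of \<open>V\<close> inherit the rate
  \<open>n powr (1 - \<delta>)\<close> from \<open>B\<close>, since those of \<open>A\<close> are of smaller order; the two contributions,
  through the numerator and through \<open>1/D\<close>, have opposite signs, and their sum is a positive multiple
  of \<open>(m0 / (m0 + m1))\<^sup>2\<close>. The inverse is controlled because \<open>D\<close> does not vanish on the closed
  disc: its value at \<open>1\<close> is \<open>m0 + m1\<close>, and elsewhere \<open>(1 - z) D(z) = 1 - a(z) b(z)\<close> with
  \<open>|a(z)| \<le> 1\<close> and \<open>|b(z)| < 1\<close>.\<close>

lemma covariance_asymptotics:
  fixes \<gamma> \<delta> :: real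
  assumes d: "2 < \<delta>" "\<delta> < \<gamma>"
  defines "A \<equiv> survival_fps \<gamma>" and "B \<equiv> survival_fps \<delta>"
  defines "m0 \<equiv> fps_value A 1" and "m1 \<equiv> fps_value B (1::real)"
  assumes K: "cycle_fps \<gamma> \<delta> * ((1 - fps_X) * K)
      = fps_const (m0 * m1 / (m0 + m1)) * cycle_fps \<gamma> \<delta> - fps_X * (A * B)"
  shows "\<exists>L>0. (\<lambda>n. real n powr (\<delta> - 2) * K $ n) \<longlonglongrightarrow> L"
proof -
  have g: "2 < \<gamma>" and s1: "1 < \<delta>" "1 < \<gamma>" and s: "1 < \<delta> - 1" using d by auto
  note l1 = survival_l1[OF g, folded A_def] survival_l1[OF d(1), folded B_def]
  have m: "1 \<le> m0" "1 \<le> m1" unfolding m0_def m1_def A_def B_def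
    using survival_value_ge_1 g d(1) by auto
  define l where "l = 1 / ((\<delta> - 1) * zeta \<delta>)"
  have l: "0 < l" using zeta_pos[OF s1(1)] s1 by (simp add: l_def)
  define D where "D = cycle_fps \<gamma> \<delta>"
  have D: "D = A + B - (1 - fps_X) * (A * B)" by (simp add: D_def cycle_fps_def A_def B_def)
  have tA: "has_tail (\<delta> - 1) A 0" unfolding A_def by (rule survival_tail_less[OF s1(2) d(2)])
  have tB: "has_tail (\<delta> - 1) B l" unfolding B_def l_def by (rule survival_tail[OF s1(1)])
  have tAB: "has_tail (\<delta> - 1) (A * B) (l * m0)"
    using has_tail_mult[OF tA tB s] by (simp add: m0_def)
  have vAB: "fps_value (A * B) 1 = m0 * m1"
    unfolding m0_def m1_def by (rule fps_value_mult[OF l1]) simp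
  have t1X: "has_tail (\<delta> - 1) (1 - fps_X) (0 - 0)" by (intro has_tail_diff has_tail_1 has_tail_X)
  have l11X: "l1_fps (1 - fps_X)" by (intro l1_diff l1_1 l1_X)
  have v1X: "fps_value (1 - fps_X) z = 1 - z" if "norm z \<le> 1" for z :: "'a::{real_normed_field,banach}"
    using fps_value_diff[OF l1_1 l1_X that] by simp
  have "has_tail (\<delta> - 1) ((1 - fps_X) * (A * B)) 0"
    using has_tail_mult[OF t1X tAB s] v1X[of "1::real"] by simp
  then have tD: "has_tail (\<delta> - 1) D l"
    unfolding D using has_tail_diff[OF has_tail_add[OF tA tB]] by fastforce
  have l1AB: "l1_fps (A * B)" and l1D: "l1_fps D"
    unfolding D by (intro l1_diff l1_add l1_mult l1 l11X)+
  have vD: "fps_value D 1 = m0 + m1"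
    unfolding D m0_def m1_def
    by (simp add: fps_value_diff fps_value_add fps_value_mult l1 l1_add l1_mult l1AB l11X v1X)
  have nz: "fps_value D z \<noteq> 0" if z: "norm z \<le> 1" for z :: complex
  proof (cases "z = 1")
    case True
    have "fps_value D (1::complex) = of_real (fps_value D 1)"
      unfolding fps_value_def using l1_summable_value(2)[OF l1D, of "1::real"]
      by (simp add: suminf_of_real)
    then show ?thesis using True vD m by (simp del: of_real_add add: of_real_eq_0_iff)
  next
    case False
    let ?a = "block_fps \<gamma>" and ?b = "block_fps \<delta>"
    have "(1 - fps_X) * D = 1 - ?a * ?b"
    proof -
      have "a = 1 - (1 - X) * A' \<Longrightarrow> b = 1 - (1 - X) * B' \<Longrightarrow> D' = A' + B' - (1 - X) * (A' * B')
          \<Longrightarrow> (1 - X) * D' = 1 - a * b" for a b X A' B' D' :: "real fps"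
        by algebra
      from this[OF block_eq[OF s1(2)] block_eq[OF s1(1)] D[unfolded A_def B_def]] show ?thesis .
    qed
    then have "(1 - z) * fps_value D z = fps_value (1 - ?a * ?b) z"
      using fps_value_mult[OF l11X l1D z] v1X[OF z] by metis
    also have "\<dots> = 1 - fps_value ?a z * fps_value ?b z"
      using fps_value_diff[OF l1_1 l1_mult[OF block_l1[OF s1(2)] block_l1[OF s1(1)]] z]
        fps_value_mult[OF block_l1[OF s1(2)] block_l1[OF s1(1)] z] by simp
    also have "\<dots> \<noteq> 0"
    proof
      assume "1 - fps_value ?a z * fps_value ?b z = 0"
      then have "norm (fps_value ?a z) * norm (fps_value ?b z) = 1"
        by (metis eq_iff_diff_eq_0 norm_mult norm_one)
      moreover have "norm (fps_value ?a z) * norm (fps_value ?b z) \<le> 1 * norm (fps_value ?b z)"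
        by (intro mult_right_mono block_norm_le(1)[OF s1(2) z]) auto
      ultimately show False using block_norm_le(2)[OF s1(1) z False] by simp
    qed
    finally show ?thesis by auto
  qed
  have D0: "D $ 0 \<noteq> 0" using nz[of 0] by (auto simp: fps_value_def)
  have tI: "has_tail (\<delta> - 1) (inverse D) (- l * (fps_value (inverse D) 1)\<^sup>2)"
    using tD s nz by (rule has_tail_inverse)
  have l1I: "l1_fps (inverse D)" using tI s by (rule has_tail_l1)
  have vI: "fps_value (inverse D) 1 = 1 / (m0 + m1)"
  proof -
    have "fps_value (D * inverse D) (1::real) = fps_value D 1 * fps_value (inverse D) 1"
      by (rule fps_value_mult[OF l1D l1I]) simp
    then show ?thesis using m by (simp add: inverse_mult_eq_1'[OF D0] vD field_simps)
  qed
  define V where "V = fps_X * ((A * B) * inverse D)"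
  define c where "c = m0 * m1 / (m0 + m1)"
  have l1ABI: "l1_fps ((A * B) * inverse D)" by (intro l1_mult l1AB l1I)
  have vABI: "fps_value ((A * B) * inverse D) 1 = c"
    using fps_value_mult[OF l1AB l1I, of "1::real"] vAB vI by (simp add: c_def)
  have "has_tail (\<delta> - 1) ((A * B) * inverse D)
      (- l * (fps_value (inverse D) 1)\<^sup>2 * fps_value (A * B) 1 + l * m0 * fps_value (inverse D) 1)"
    by (rule has_tail_mult[OF tAB tI s])
  from has_tail_mult[OF has_tail_X this s]
  have tV: "has_tail (\<delta> - 1) V (- l * (1 / (m0 + m1))\<^sup>2 * (m0 * m1) + l * m0 * (1 / (m0 + m1)))"
    unfolding V_def vI vAB by simp
  have l1V: "l1_fps V" unfolding V_def by (intro l1_mult l1_X l1ABI)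
  have vV: "fps_value V 1 = c"
    unfolding V_def using fps_value_mult[OF l1_X l1ABI, of "1::real"] vABI by simp
  define L where "L = - l * (1 / (m0 + m1))\<^sup>2 * (m0 * m1) + l * m0 * (1 / (m0 + m1))"
  have "L = l * (m0 / (m0 + m1))\<^sup>2"
  proof -
    have "L = l * (m0 / (m0 + m1)) * (1 - m1 / (m0 + m1))"
      unfolding L_def by (simp add: power2_eq_square right_diff_distrib)
    also have "1 - m1 / (m0 + m1) = m0 / (m0 + m1)" using m by (simp add: field_simps)
    finally show ?thesis by (simp add: power2_eq_square)
  qed
  then have L: "0 < L" using l m by simp
  have sV: "summable (\<lambda>n. V $ n)" and sumV: "(\<Sum>n. V $ n) = c"
    using l1_summable_value(2)[OF l1V, of "1::real"] vV by (auto simp: fps_value_def)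
  have KV: "(1 - fps_X) * K = fps_const c - V"
  proof -
    have "D * ((1 - fps_X) * K) = D * (fps_const c - V)"
    proof -
      have "D * V = fps_X * (A * B)"
      proof -
        have "D * V = (D * inverse D) * (fps_X * (A * B))" unfolding V_def by (simp only: mult_ac)
        then show ?thesis by (simp only: inverse_mult_eq_1'[OF D0] mult_1_left)
      qed
      then show ?thesis using K unfolding D_def c_def
        by (simp only: right_diff_distrib mult.commute)
    qed
    moreover have "D \<noteq> 0" using D0 by auto
    ultimately show ?thesis by simp
  qed
  have Kn: "K $ n = c - (\<Sum>k\<le>n. V $ k)" for n
  proof (induction n)
    case 0
    have "((1 - fps_X) * K) $ 0 = K $ 0" by simp
    then show ?case using KV by simp
  next
    case (Suc n)
    have "((1 - fps_X) * K) $ Suc n = K $ Suc n - K $ n" by (simp add: left_diff_distrib)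
    then have "K $ Suc n = K $ n - V $ Suc n" using KV by simp
    then show ?case using Suc by simp
  qed
  have "K $ n = (\<Sum>k. V $ (k + Suc n))" for n
    using suminf_minus_initial_segment[OF sV, of "Suc n"] sumV Kn[of n] by (simp add: lessThan_Suc_atMost)
  moreover have "(\<lambda>n. real n powr (\<delta> - 1 - 1) * (\<Sum>k. V $ (k + Suc n))) \<longlonglongrightarrow> L / (\<delta> - 1 - 1)"
    using tail_sum_limit[OF s _ sV] tV unfolding has_tail_def L_def by blast
  ultimately have "(\<lambda>n. real n powr (\<delta> - 2) * K $ n) \<longlonglongrightarrow> L / (\<delta> - 2)" by simp
  moreover have "0 < L / (\<delta> - 2)" using L d by simp
  ultimately show ?thesis by blast
qed

section \<open>Clopen sets and the dual of the Ruelle operator\<close>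

definition clopen :: "binseq set \<Rightarrow> bool" where
  "clopen E \<longleftrightarrow> open E \<and> closed E"

lemma clopen_coord: "clopen {x::binseq. x i = b}"
proof -
  have cont: "continuous_on UNIV (\<lambda>x::binseq. x i)" by (rule continuous_on_product_coordinates)
  have eq: "{x::binseq. x i = b} = (\<lambda>x. x i) -` {b}" by auto
  show ?thesis unfolding clopen_def eq closed_def vimage_Compl[symmetric]
    by (intro conjI open_vimage cont Topological_Spaces.discrete_topology_class.open_discrete)
qed

lemma clopen_Int: "clopen E \<Longrightarrow> clopen F \<Longrightarrow> clopen (E \<inter> F)"
  unfolding clopen_def by auto

lemma clopen_shift:
  assumes "clopen E" shows "clopen {x. shift x \<in> E}"
proof -
  have cont: "continuous_on UNIV shift"
    unfolding shift_def by (intro continuous_on_coordinatewise_then_product continuous_on_product_coordinates)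
  have eq: "{x. shift x \<in> E} = shift -` E" by auto
  show ?thesis using assms unfolding clopen_def eq
    using open_vimage[OF _ cont] closed_vimage[OF _ cont] by auto
qed

lemma clopen_borel: "clopen E \<Longrightarrow> E \<in> sets borel"
  by (simp add: clopen_def)

lemma clopen_indicator_continuous:
  assumes "clopen E" shows "continuous_on UNIV (indicator E :: binseq \<Rightarrow> real)"
proof -
  have "continuous_on (E \<union> - E) (\<lambda>x. if x \<in> E then 1 else (0::real))"
    using assms unfolding clopen_def by (intro continuous_on_If continuous_on_const) auto
  moreover have "indicator E = (\<lambda>x. if x \<in> E then 1 else (0::real))" by (auto simp: indicator_def)
  ultimately show ?thesis by simp
qed

definition prepend :: "bool \<Rightarrow> binseq \<Rightarrow> binseq" where
  "prepend b x = case_nat b x"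

lemma prepend_simps [simp]: "prepend b x 0 = b" "prepend b x (Suc i) = x i" "shift (prepend b x) = x"
  by (auto simp: prepend_def shift_def)

lemma shift_preimage: "{y. shift y = x} = {prepend False x, prepend True x}"
proof -
  have "y = prepend (y 0) (shift y)" for y
  proof
    fix i show "y i = prepend (y 0) (shift y) i" by (cases i) (auto simp: shift_def)
  qed
  then have "y = prepend False (shift y) \<or> y = prepend True (shift y)" for y
    by (metis (full_types))
  then show ?thesis by auto
qed

lemma ruelle_eq:
  "ruelle g \<psi> x = exp (g (prepend False x)) * \<psi> (prepend False x) + exp (g (prepend True x)) * \<psi> (prepend True x)"
proof -
  have "prepend False x \<noteq> prepend True x" by (metis prepend_simps(1))
  then show ?thesis unfolding ruelle_def shift_preimage by simp
qed

lemma funpow_shift: "(shift ^^ n) x i = x (i + n)"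
  by (induction n arbitrary: x i) (auto simp: shift_def funpow_swap1 simp del: funpow.simps(2) simp add: funpow_Suc_right)

text \<open>The duality tested on the indicator of the clopen set of sequences \<open>b x\<close> with \<open>x \<in> E\<close>: the
  Ruelle operator turns it into \<open>w\<close> times the indicator of \<open>E\<close>.\<close>

lemma eigenprobability_prepend:
  assumes nu: "eigenprobability g \<nu>" and E: "clopen E"
    and w: "\<And>x. x \<in> E \<Longrightarrow> exp (g (prepend b x)) = w"
  shows "measure \<nu> {y. y 0 = b \<and> shift y \<in> E} = w * measure \<nu> E"
proof -
  define F where "F = {y. y 0 = b \<and> shift y \<in> E}"
  have F: "clopen F"
    using clopen_Int[OF clopen_coord clopen_shift[OF E]] unfolding F_def Int_def by simp
  have space: "space \<nu> = UNIV" and sets: "sets \<nu> = sets borel"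
    using nu sets_eq_imp_space_eq[of \<nu> borel] by (auto simp: eigenprobability_def)
  have "(\<integral>x. indicator F x \<partial>\<nu>) = (\<integral>x. ruelle g (indicator F) x \<partial>\<nu>)"
    using nu clopen_indicator_continuous[OF F] unfolding eigenprobability_def ruelle_dual_def by blast
  moreover have "ruelle g (indicator F) x = w * indicator E x" for x
    unfolding ruelle_eq F_def using w by (cases b) (auto simp: indicator_def)
  ultimately have "measure \<nu> F = w * measure \<nu> E"
    by (simp add: space)
  then show ?thesis by (simp add: F_def)
qed

definition block :: "bool \<Rightarrow> nat \<Rightarrow> binseq set" where
  "block b n = {x. (\<forall>i<n. x i = b) \<and> x n \<noteq> b}"

lemma L_block_eq: "L_block n = block False n" and R_block_eq: "R_block n = block True n"
  by (auto simp: block_def L_block_def R_block_def)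

lemma exp_double_hofbauer_1:
  assumes "1 < \<gamma>" "1 < \<delta>" "x 0 \<noteq> b"
  shows "exp (double_hofbauer \<gamma> \<delta> (prepend b x)) = 1 / zeta (if b then \<delta> else \<gamma>)"
proof -
  have "prepend b x \<in> block b 1" using assms(3) by (auto simp: block_def)
  then show ?thesis
    using double_hofbauer_cases(3,4)[of "prepend b x"] zeta_pos[OF assms(1)] zeta_pos[OF assms(2)]
    by (cases b) (auto simp: L_block_eq R_block_eq exp_minus inverse_eq_divide)
qed

lemma exp_double_hofbauer_Suc:
  assumes "x \<in> block b (Suc n)"
  shows "exp (double_hofbauer \<gamma> \<delta> (prepend b x)) = (real (Suc n) / real (Suc (Suc n))) powr (if b then \<delta> else \<gamma>)"
proof -
  have y: "prepend b x \<in> block b (Suc (Suc n))"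
    using assms by (auto simp: block_def less_Suc_eq_0_disj)
  have "exp (- s * ln (real (Suc (Suc n)) / (real (Suc (Suc n)) - 1))) = (real (Suc n) / real (Suc (Suc n))) powr s" for s
  proof -
    have "ln (real (Suc n) / real (Suc (Suc n))) = - ln (real (Suc (Suc n)) / (real (Suc (Suc n)) - 1))"
      by (simp add: ln_div)
    then show ?thesis unfolding powr_def by simp
  qed
  then show ?thesis
    using y double_hofbauer_cases(5,6)[of "Suc (Suc n)" "prepend b x"] by (cases b) (auto simp: L_block_eq R_block_eq)
qed

section \<open>Renewal structure of the eigenmeasure\<close>

locale hofbauer_eigenmeasure =
  fixes \<gamma> \<delta> :: real and \<nu> :: "binseq measure"
  assumes gamma: "2 < \<gamma>" and delta: "2 < \<delta>"
    and eigen: "eigenprobability (double_hofbauer \<gamma> \<delta>) \<nu>"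
begin

definition expo :: "bool \<Rightarrow> real" where "expo b = (if b then \<delta> else \<gamma>)"

lemma expo_gt: "2 < expo b" "1 < expo b" using gamma delta by (auto simp: expo_def)

sublocale prob_space \<nu> using eigen by (simp add: eigenprobability_def)

lemma sets_nu [simp, measurable_cong]: "sets \<nu> = sets borel" using eigen by (simp add: eigenprobability_def)
lemma space_nu [simp]: "space \<nu> = UNIV" using sets_eq_imp_space_eq[OF sets_nu] by simp

definition start :: "bool \<Rightarrow> binseq set" where "start b = {x. x 0 = b}"

definition after_block :: "bool \<Rightarrow> nat \<Rightarrow> binseq set \<Rightarrow> binseq set" where
  "after_block b k E = {y. (\<forall>i<k. y i = b) \<and> (shift ^^ k) y \<in> E}"

lemma after_block_Suc: "after_block b (Suc k) E = {y. y 0 = b \<and> shift y \<in> after_block b k E}"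
  by (auto simp: after_block_def funpow_Suc_right less_Suc_eq_0_disj shift_def simp del: funpow.simps(2))

lemma after_block_sub: "E \<subseteq> start (\<not> b) \<Longrightarrow> after_block b k E \<subseteq> block b k"
  by (auto simp: after_block_def block_def start_def funpow_shift)

lemma after_block_clopen: "clopen E \<Longrightarrow> clopen (after_block b k E)"
proof (induction k)
  case 0 then show ?case by (simp add: after_block_def)
next
  case (Suc k)
  show ?case
    using clopen_Int[OF clopen_coord clopen_shift[OF Suc.IH[OF Suc.prems]]] unfolding after_block_Suc Int_def by simp
qed

text \<open>The weights \<open>1 / zeta s\<close>, \<open>(1 / 2) powr s\<close>, ..., \<open>(k / (k + 1)) powr s\<close> collected by prepending the
  symbols of a block one at a time telescope. Thus under \<open>\<nu>\<close> the lengths of consecutive blocks are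
  independent.\<close>

lemma measure_after_block:
  assumes E: "clopen E" "E \<subseteq> start (\<not> b)"
  shows "measure \<nu> (after_block b (Suc k) E) = block_fps (expo b) $ (Suc k) * measure \<nu> E"
proof (induction k)
  case 0
  have "after_block b (Suc 0) E = {y. y 0 = b \<and> shift y \<in> E}"
    unfolding after_block_Suc by (simp add: after_block_def)
  moreover have "measure \<nu> {y. y 0 = b \<and> shift y \<in> E} = 1 / zeta (expo b) * measure \<nu> E"
    using E(2) gamma delta unfolding expo_def start_def
    by (intro eigenprobability_prepend[OF eigen E(1)] exp_double_hofbauer_1) auto
  ultimately show ?case by (simp add: block_fps_def)
next
  case (Suc k)
  have "measure \<nu> (after_block b (Suc (Suc k)) E)
      = (real (Suc k) / real (Suc (Suc k))) powr expo b * measure \<nu> (after_block b (Suc k) E)"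
    unfolding after_block_Suc[of b "Suc k"] expo_def using after_block_sub[OF E(2), of "Suc k"]
    by (intro eigenprobability_prepend[OF eigen after_block_clopen[OF E(1)]] exp_double_hofbauer_Suc) auto
  also have "\<dots> = ((real (Suc k) / real (Suc (Suc k))) powr expo b * real (Suc k) powr - expo b) / zeta (expo b) * measure \<nu> E"
    unfolding Suc by (simp add: block_fps_def)
  also have "(real (Suc k) / real (Suc (Suc k))) powr expo b * real (Suc k) powr - expo b = real (Suc (Suc k)) powr - expo b"
    unfolding powr_divide powr_minus by (simp add: field_simps)
  finally show ?case by (simp add: block_fps_def)
qed

lemma block_eq_after_block: "block b k = after_block b k (start (\<not> b))"
  by (auto simp: after_block_def block_def start_def funpow_shift)

lemma start_clopen: "clopen (start b)" unfolding start_def by (rule clopen_coord)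

lemma block_borel [measurable, simp]: "block b k \<in> sets borel"
  unfolding block_eq_after_block by (intro clopen_borel after_block_clopen start_clopen)

lemma start_borel [measurable, simp]: "start b \<in> sets borel"
  by (intro clopen_borel start_clopen)

lemma start_decomp: "start b = {\<lambda>_. b} \<union> (\<Union>k. block b (Suc k))"
proof (intro equalityI subsetI)
  fix x assume x: "x \<in> start b"
  show "x \<in> {\<lambda>_. b} \<union> (\<Union>k. block b (Suc k))"
  proof (cases "x = (\<lambda>_. b)")
    case False
    then have ex: "\<exists>n. x n \<noteq> b" by auto
    define n where "n = (LEAST n. x n \<noteq> b)"
    have n: "x n \<noteq> b" "\<And>i. i < n \<Longrightarrow> x i = b"
      unfolding n_def using LeastI_ex[OF ex] not_less_Least by blast+
    have "n \<noteq> 0" using n(1) x by (intro notI) (simp add: start_def)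
    then show ?thesis using n by (auto simp: block_def gr0_conv_Suc intro!: exI[of _ "n - 1"])
  qed simp
qed (auto simp: start_def block_def)

lemma block_unique: "x \<in> block b m \<Longrightarrow> x \<in> block b n \<Longrightarrow> m = n"
  unfolding block_def mem_Collect_eq by (metis linorder_neqE_nat)

lemma block_disjoint: "disjoint_family (\<lambda>k. block b (Suc k))"
  unfolding disjoint_family_on_def using block_unique by blast

lemma const_borel [simp]: "{\<lambda>_. b} \<in> sets (borel :: binseq measure)"
proof -
  have "{\<lambda>_. b} = start b - (\<Union>k. block b (Suc k))"
    unfolding start_decomp[of b] by (auto simp: block_def)
  then show ?thesis by simp
qed

lemma measure_blocks_sums:
  assumes "finite_measure N" "sets N = sets borel" "S \<in> sets borel"
  shows "(\<lambda>k. measure N (S \<inter> block b (Suc k))) sums (measure N (S \<inter> start b) - measure N (S \<inter> {\<lambda>_. b}))"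
proof -
  interpret N: finite_measure N by fact
  have "(\<lambda>k. measure N (S \<inter> block b (Suc k))) sums measure N (\<Union>k. S \<inter> block b (Suc k))"
  proof (rule N.finite_measure_UNION)
    show "range (\<lambda>k. S \<inter> block b (Suc k)) \<subseteq> sets N"
      unfolding assms(2) using assms(3) by (intro image_subsetI sets.Int block_borel)
    show "disjoint_family (\<lambda>k. S \<inter> block b (Suc k))"
      using block_disjoint[of b] unfolding disjoint_family_on_def by blast
  qed
  moreover have "measure N (S \<inter> start b) = measure N (S \<inter> {\<lambda>_. b}) + measure N (\<Union>k. S \<inter> block b (Suc k))"
  proof -
    have eq: "S \<inter> start b = (S \<inter> {\<lambda>_. b}) \<union> (\<Union>k. S \<inter> block b (Suc k))"
      unfolding start_decomp[of b] Int_Un_distrib Int_UN_distrib ..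
    show ?thesis unfolding eq
    proof (rule N.finite_measure_Union)
      have "(\<lambda>_. b) \<notin> block b k" for k by (simp add: block_def)
      then show "S \<inter> {\<lambda>_. b} \<inter> (\<Union>k. S \<inter> block b (Suc k)) = {}" by blast
      show "S \<inter> {\<lambda>_. b} \<in> sets N" "(\<Union>k. S \<inter> block b (Suc k)) \<in> sets N"
        unfolding assms(2) using assms(3) by (intro sets.Int sets.countable_UN image_subsetI const_borel block_borel | assumption)+
    qed
  qed
  ultimately show ?thesis by (simp only: add_diff_cancel_left')
qed

lemma block_fps_sums: "(\<lambda>k. block_fps (expo b) $ (Suc k)) sums 1"
proof -
  have "summable (\<lambda>k. block_fps (expo b) $ (k + Suc 0))" by (rule block_tail_summable[OF expo_gt(2)])
  moreover have "(\<Sum>k. block_fps (expo b) $ (k + Suc 0)) = 1"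
    using survival_0[OF expo_gt(2), of b] by (simp add: survival_fps_def)
  ultimately show ?thesis by (simp add: sums_iff)
qed

text \<open>The blocks of symbol \<open>b\<close> have total measure \<open>\<nu> (start (\<not> b))\<close>, hence \<open>\<nu> (start b)\<close>
  exceeds \<open>\<nu> (start (\<not> b))\<close> by the mass of the constant sequence \<open>b\<close>. This holds for both
  symbols, so both masses vanish.\<close>

lemma nu_const: "measure \<nu> {\<lambda>_. b} = 0" and nu_start: "measure \<nu> (start b) = 1 / 2"
proof -
  have eq: "measure \<nu> (start b) - measure \<nu> {\<lambda>_. b} = measure \<nu> (start (\<not> b))" for b
  proof -
    have 1: "(\<lambda>k. measure \<nu> (block b (Suc k))) sums (measure \<nu> (start b) - measure \<nu> {\<lambda>_. b})"
      using measure_blocks_sums[of \<nu> UNIV b] finite_measure_axioms by simp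
    have 2: "(\<lambda>k. measure \<nu> (block b (Suc k))) sums (1 * measure \<nu> (start (\<not> b)))"
      unfolding block_eq_after_block
      using sums_mult2[OF block_fps_sums] by (subst measure_after_block[OF start_clopen subset_refl])
    show ?thesis using sums_unique2[OF 1 2] by simp
  qed
  have "measure \<nu> (start True) + measure \<nu> (start False) = 1"
  proof -
    have "measure \<nu> (start True \<union> start False) = measure \<nu> (start True) + measure \<nu> (start False)"
    proof (rule finite_measure_Union)
      show "start True \<inter> start False = {}" by (auto simp: start_def)
    qed simp_all
    moreover have "start True \<union> start False = space \<nu>" by (auto simp: start_def)
    moreover have "prob UNIV = 1" using prob_space by simp
    ultimately show ?thesis by simp
  qed
  moreover have "measure \<nu> (start True) - measure \<nu> {\<lambda>_. True} = measure \<nu> (start False)"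
      "measure \<nu> (start False) - measure \<nu> {\<lambda>_. False} = measure \<nu> (start True)"
    using eq[of True] eq[of False] by simp_all
  moreover have "0 \<le> measure \<nu> {\<lambda>_. True}" "0 \<le> measure \<nu> {\<lambda>_. False}" by simp_all
  ultimately have "measure \<nu> {\<lambda>_. True} = 0 \<and> measure \<nu> (start True) = 1 / 2"
    and "measure \<nu> {\<lambda>_. False} = 0 \<and> measure \<nu> (start False) = 1 / 2"
    by (intro conjI; linarith)+
  then have both: "\<forall>b. measure \<nu> {\<lambda>_. b} = 0 \<and> measure \<nu> (start b) = 1 / 2"
    unfolding all_bool_eq by (rule conjI)
  show "measure \<nu> {\<lambda>_. b} = 0" by (rule both[THEN spec, THEN conjunct1])
  show "measure \<nu> (start b) = 1 / 2" by (rule both[THEN spec, THEN conjunct2])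
qed

definition zero_at :: "nat \<Rightarrow> binseq set" where "zero_at n = {x. \<not> x n}"

lemma zero_at_clopen: "clopen (zero_at n)"
  using clopen_coord[of n False] by (simp add: zero_at_def)

lemma zero_at_borel [measurable, simp]: "zero_at n \<in> sets borel"
  by (intro clopen_borel zero_at_clopen)

lemma nu_zero_at_block:
  "measure \<nu> (zero_at n \<inter> block b (Suc k)) =
     (if Suc k \<le> n then block_fps (expo b) $ (Suc k) * measure \<nu> (zero_at (n - Suc k) \<inter> start (\<not> b))
      else if b then 0 else block_fps (expo b) $ (Suc k) / 2)"
proof (cases "Suc k \<le> n")
  case True
  then have eq: "zero_at n \<inter> block b (Suc k) = after_block b (Suc k) (zero_at (n - Suc k) \<inter> start (\<not> b))"
    unfolding zero_at_def block_def after_block_def start_def funpow_shift by auto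
  show ?thesis
    unfolding eq measure_after_block[OF clopen_Int[OF zero_at_clopen start_clopen] Int_lower2]
    by (simp only: True if_True)
next
  case False
  show ?thesis
  proof (cases b)
    case True
    then have "zero_at n \<inter> block b (Suc k) = {}" using False by (auto simp: zero_at_def block_def)
    then show ?thesis using False True by simp
  next
    case b: False
    then have eq: "zero_at n \<inter> block b (Suc k) = block b (Suc k)" using False by (auto simp: zero_at_def block_def)
    have "measure \<nu> (zero_at n \<inter> block b (Suc k)) = block_fps (expo b) $ (Suc k) * (1 / 2)"
      unfolding eq unfolding block_eq_after_block measure_after_block[OF start_clopen subset_refl] nu_start ..
    then show ?thesis using False b by simp
  qed
qed

section \<open>The measure weighted by the eigenfunction\<close>

text \<open>The equilibrium measure before normalization.\<close>

definition weighted :: "binseq measure" where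
  "weighted = density \<nu> (eigenfunction \<gamma> \<delta>)"

lemma eigenfunction_block:
  "x \<in> block b (Suc k) \<Longrightarrow> eigenfunction \<gamma> \<delta> x = ennreal (eigenfunction_branch (expo b) (Suc k))"
  using eigenfunction_cases(3,4)[of "Suc k" x] by (cases b) (auto simp: L_block_eq R_block_eq expo_def)

lemma eigenfunction_branch_eq:
  assumes s: "1 < s"
  shows "eigenfunction_branch s (Suc k) = real (Suc k) powr s * (\<Sum>j. real (j + Suc k) powr - s)"
proof -
  have summ: "summable (\<lambda>j. real (j + Suc k) powr - s)" by (rule powr_tail_summable[OF s])
  have "(\<Sum>\<^sub>\<infinity>j\<in>{2..}. real (j + Suc k - 1) powr - s) = (\<Sum>j. real (j + 2 + Suc k - 1) powr - s)"
    using powr_tail_summable[OF s, of "Suc (Suc k)"] by (intro infsum_atLeast_nat) auto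
  also have "\<dots> = (\<Sum>j. real (Suc j + Suc k) powr - s)" by simp
  also have "\<dots> = (\<Sum>j. real (j + Suc k) powr - s) - real (Suc k) powr - s"
    using suminf_split_head[OF summ] by simp
  finally show ?thesis
    unfolding eigenfunction_branch_def by (simp add: right_diff_distrib powr_minus)
qed

text \<open>The eigenfunction is exactly the factor that turns block probabilities into survival probabilities,
  as for the first block of a stationary renewal process.\<close>

lemma branch_block:
  "eigenfunction_branch (expo b) (Suc k) * block_fps (expo b) $ (Suc k) = survival_fps (expo b) $ k"
  "0 \<le> eigenfunction_branch (expo b) (Suc k)"
proof -
  show "eigenfunction_branch (expo b) (Suc k) * block_fps (expo b) $ (Suc k) = survival_fps (expo b) $ k"
    unfolding eigenfunction_branch_eq[OF expo_gt(2)] survival_nth[OF expo_gt(2)]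
    by (simp add: block_fps_def powr_minus)
  show "0 \<le> eigenfunction_branch (expo b) (Suc k)"
    unfolding eigenfunction_branch_eq[OF expo_gt(2)]
    by (intro mult_nonneg_nonneg suminf_nonneg powr_tail_summable expo_gt) auto
qed

lemma UNIV_blocks: "UNIV = (\<Union>n. (if n = 0 then {zeros, ones} else block False n \<union> block True n))"
proof -
  have "x \<in> (\<Union>n. (if n = 0 then {zeros, ones} else block False n \<union> block True n))" for x
  proof -
    have "x \<in> start (x 0)" by (simp add: start_def)
    then consider "x = zeros" | "x = ones" | k where "x \<in> block False (Suc k)" | k where "x \<in> block True (Suc k)"
      unfolding start_decomp zeros_def ones_def by (cases "x 0") auto
    then show ?thesis
    proof cases
      case 1 then show ?thesis by (intro UN_I[of 0]) auto
    next
      case 2 then show ?thesis by (intro UN_I[of 0]) auto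
    next
      case (3 k) then show ?thesis by (intro UN_I[of "Suc k"]) auto
    next
      case (4 k) then show ?thesis by (intro UN_I[of "Suc k"]) auto
    qed
  qed
  then show ?thesis by blast
qed

text \<open>The eigenfunction is constant on each piece of a countable partition.\<close>

lemma eigenfunction_measurable [measurable]: "eigenfunction \<gamma> \<delta> \<in> borel_measurable borel"
proof (rule measurable_piecewise_restrict2)
  show "(if n = 0 then {zeros, ones} else block False n \<union> block True n) \<in> sets borel" for n
  proof -
    have "{zeros, ones} = {\<lambda>_. False} \<union> {\<lambda>_. True}" by (auto simp: zeros_def ones_def)
    then show ?thesis by (metis block_borel const_borel sets.Un)
  qed
  show "space borel = (\<Union>n. (if n = 0 then {zeros, ones} else block False n \<union> block True n))"
    using UNIV_blocks by simp
  fix n :: nat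
  show "\<exists>h\<in>borel_measurable borel. \<forall>x\<in>(if n = 0 then {zeros, ones} else block False n \<union> block True n).
      eigenfunction \<gamma> \<delta> x = h x"
  proof (cases n)
    case 0
    then show ?thesis by (intro bexI[of _ "\<lambda>_. \<infinity>"]) (auto simp: eigenfunction_def)
  next
    case (Suc k)
    let ?c = "\<lambda>b. ennreal (eigenfunction_branch (expo b) (Suc k))"
    have "(\<lambda>x. if x \<in> start True then ?c True else ?c False) \<in> borel_measurable borel"
      by measurable
    moreover have "eigenfunction \<gamma> \<delta> x = (if x \<in> start True then ?c True else ?c False)"
      if "x \<in> block False (Suc k) \<union> block True (Suc k)" for x
      using that eigenfunction_block[of x True k] eigenfunction_block[of x False k]
      by (auto simp: start_def block_def)
    ultimately show ?thesis using Suc by (intro bexI[of _ "\<lambda>x. if x \<in> start True then ?c True else ?c False"]) simp_all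
  qed
qed

lemma eigenfunction_measurable_nu [measurable]: "eigenfunction \<gamma> \<delta> \<in> borel_measurable \<nu>"
  using eigenfunction_measurable by (simp cong: measurable_cong_sets)

lemma sets_weighted [simp]: "sets weighted = sets borel" and space_weighted [simp]: "space weighted = UNIV"
  by (simp_all add: weighted_def)

lemma emeasure_weighted_block:
  assumes S: "S \<in> sets borel"
  shows "emeasure weighted (S \<inter> block b (Suc k))
    = ennreal (eigenfunction_branch (expo b) (Suc k) * measure \<nu> (S \<inter> block b (Suc k)))"
proof -
  let ?c = "eigenfunction_branch (expo b) (Suc k)" and ?T = "S \<inter> block b (Suc k)"
  have "emeasure weighted ?T = (\<integral>\<^sup>+ x. eigenfunction \<gamma> \<delta> x * indicator ?T x \<partial>\<nu>)"
    unfolding weighted_def using S by (intro emeasure_density) auto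
  also have "\<dots> = (\<integral>\<^sup>+ x. ennreal ?c * indicator ?T x \<partial>\<nu>)"
    using eigenfunction_block[of _ b k] by (intro nn_integral_cong) (auto simp: indicator_def)
  also have "\<dots> = ennreal ?c * emeasure \<nu> ?T"
    using S by (intro nn_integral_cmult_indicator) auto
  finally show ?thesis using branch_block(2) by (simp add: emeasure_eq_measure ennreal_mult)
qed

lemma emeasure_weighted_const: "emeasure weighted {\<lambda>_. b} = 0"
proof -
  have "{\<lambda>_. b} \<in> null_sets \<nu>"
    using nu_const by (intro null_setsI) (auto simp: emeasure_eq_measure)
  then have "(\<integral>\<^sup>+ x. eigenfunction \<gamma> \<delta> x * indicator {\<lambda>_. b} x \<partial>\<nu>) = 0"
    by (rule nn_integral_null_set)
  moreover have "emeasure weighted {\<lambda>_. b} = (\<integral>\<^sup>+ x. eigenfunction \<gamma> \<delta> x * indicator {\<lambda>_. b} x \<partial>\<nu>)"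
    unfolding weighted_def by (intro emeasure_density) auto
  ultimately show ?thesis by simp
qed

definition mean :: "bool \<Rightarrow> real" where "mean b = fps_value (survival_fps (expo b)) 1"

lemma survival_sums: "(\<lambda>k. survival_fps (expo b) $ k) sums mean b"
proof -
  have "summable (\<lambda>k. of_real (survival_fps (expo b) $ k) * (1::real) ^ k)"
    by (rule l1_summable_value(2)[OF survival_l1[OF expo_gt(1)]]) simp
  then show ?thesis by (simp add: mean_def fps_value_def summable_sums)
qed

lemma mean_ge_1: "1 \<le> mean b"
  unfolding mean_def by (rule survival_value_ge_1[OF expo_gt(1)])

lemma emeasure_weighted_start: "emeasure weighted (start b) = ennreal (mean b / 2)"
proof -
  have trm: "emeasure weighted (block b (Suc k)) = ennreal (survival_fps (expo b) $ k / 2)" for k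
  proof -
    have "measure \<nu> (block b (Suc k)) = block_fps (expo b) $ (Suc k) * (1 / 2)"
      unfolding block_eq_after_block measure_after_block[OF start_clopen subset_refl] nu_start ..
    then have val: "eigenfunction_branch (expo b) (Suc k) * measure \<nu> (block b (Suc k)) = survival_fps (expo b) $ k / 2"
      unfolding branch_block(1)[symmetric] by simp
    have "emeasure weighted (block b (Suc k)) = ennreal (eigenfunction_branch (expo b) (Suc k) * measure \<nu> (block b (Suc k)))"
      using emeasure_weighted_block[of UNIV b k] by simp
    then show ?thesis unfolding val .
  qed
  have "emeasure weighted (start b) = emeasure weighted {\<lambda>_. b} + emeasure weighted (\<Union>k. block b (Suc k))"
    unfolding start_decomp[of b] by (intro plus_emeasure[symmetric]) (auto simp: block_def[of b "Suc _"] start_decomp)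
  also have "\<dots> = (\<Sum>k. emeasure weighted (block b (Suc k)))"
    using block_disjoint by (subst suminf_emeasure) (auto simp: emeasure_weighted_const)
  also have "\<dots> = ennreal (mean b / 2)"
    unfolding trm using sums_divide[OF survival_sums, of b 2] survival_nonneg[OF expo_gt(2)]
    by (intro suminf_ennreal_eq) auto
  finally show ?thesis .
qed

lemma emeasure_weighted_UNIV: "emeasure weighted UNIV = ennreal ((mean False + mean True) / 2)"
proof -
  have "UNIV = start False \<union> start True" by (auto simp: start_def)
  then have "emeasure weighted UNIV = emeasure weighted (start False \<union> start True)" by simp
  also have "\<dots> = emeasure weighted (start False) + emeasure weighted (start True)"
    by (rule plus_emeasure[symmetric]) (simp, simp, auto simp: start_def)
  also have "\<dots> = ennreal ((mean False + mean True) / 2)"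
    unfolding emeasure_weighted_start using mean_ge_1[of True] mean_ge_1[of False]
    by (subst ennreal_plus[symmetric]) (auto simp: add_divide_distrib)
  finally show ?thesis .
qed

lemma finite_weighted: "finite_measure weighted"
  by (rule finite_measureI) (simp add: emeasure_weighted_UNIV)

lemma measure_weighted_const: "measure weighted (S \<inter> {\<lambda>_. b}) = 0"
proof -
  have "emeasure weighted (S \<inter> {\<lambda>_. b}) \<le> emeasure weighted {\<lambda>_. b}" by (intro emeasure_mono) auto
  then show ?thesis by (simp add: emeasure_weighted_const measure_def)
qed

section \<open>Renewal equations\<close>

definition nu_fps :: "bool \<Rightarrow> real fps" where
  "nu_fps b = Abs_fps (\<lambda>n. measure \<nu> (zero_at n \<inter> start b))"

definition weighted_fps :: "bool \<Rightarrow> real fps" where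
  "weighted_fps b = Abs_fps (\<lambda>n. measure weighted (zero_at n \<inter> start b))"

lemma X_mult_nth_sum: "(\<Sum>k<n. u $ k * w $ (n - Suc k)) = (fps_X * (u * w)) $ n" for u w :: "real fps"
proof (cases n)
  case (Suc m)
  have "(fps_X * (u * w)) $ Suc m = (u * w) $ m" by simp
  also have "\<dots> = (\<Sum>k<Suc m. u $ k * w $ (Suc m - Suc k))"
    unfolding fps_mult_nth by (simp only: atLeast0AtMost lessThan_Suc_atMost diff_Suc_Suc)
  finally show ?thesis using Suc by simp
qed simp

lemma nu_fps_sums:
  "(\<lambda>k. if Suc k \<le> n then block_fps (expo b) $ (Suc k) * nu_fps (\<not> b) $ (n - Suc k)
      else if b then 0 else block_fps (expo b) $ (Suc k) / 2) sums (nu_fps b $ n)"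
proof -
  have "measure \<nu> (zero_at n \<inter> {\<lambda>_. b}) = 0"
    using finite_measure_mono[of "zero_at n \<inter> {\<lambda>_. b}" "{\<lambda>_. b}"] by (simp add: nu_const measure_le_0_iff)
  then show ?thesis
    using measure_blocks_sums[OF finite_measure_axioms sets_nu zero_at_borel, of n b]
    unfolding nu_zero_at_block nu_fps_def fps_nth_Abs_fps by simp
qed

lemma weighted_fps_sums:
  "(\<lambda>k. if Suc k \<le> n then survival_fps (expo b) $ k * nu_fps (\<not> b) $ (n - Suc k)
      else if b then 0 else survival_fps (expo b) $ k / 2) sums (weighted_fps b $ n)"
proof -
  have "measure weighted (zero_at n \<inter> block b (Suc k)) =
      (if Suc k \<le> n then survival_fps (expo b) $ k * nu_fps (\<not> b) $ (n - Suc k)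
      else if b then 0 else survival_fps (expo b) $ k / 2)" for k
  proof -
    have "measure weighted (zero_at n \<inter> block b (Suc k))
        = eigenfunction_branch (expo b) (Suc k) * measure \<nu> (zero_at n \<inter> block b (Suc k))"
      unfolding measure_def[of weighted] emeasure_weighted_block[OF zero_at_borel]
      using branch_block(2) by simp
    then show ?thesis
      unfolding nu_zero_at_block branch_block(1)[symmetric] by (simp add: nu_fps_def)
  qed
  then show ?thesis
    using measure_blocks_sums[OF finite_weighted sets_weighted zero_at_borel, of n b]
    by (simp add: weighted_fps_def measure_weighted_const)
qed

lemma sums_split:
  fixes u w :: "real fps" and r :: "nat \<Rightarrow> real"
  assumes "(\<lambda>k. if Suc k \<le> n then u $ k * w $ (n - Suc k) else r k) sums S"
  shows "S = (fps_X * (u * w)) $ n + (\<Sum>k. r (k + n))"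
proof -
  let ?f = "\<lambda>k. if Suc k \<le> n then u $ k * w $ (n - Suc k) else r k"
  have "S = (\<Sum>k. ?f (k + n)) + (\<Sum>k<n. ?f k)"
    using suminf_split_initial_segment[OF sums_summable[OF assms], of n] sums_unique[OF assms] by simp
  also have "(\<Sum>k<n. ?f k) = (\<Sum>k<n. u $ k * w $ (n - Suc k))" by (intro sum.cong) auto
  finally show ?thesis unfolding X_mult_nth_sum by simp
qed

text \<open>Conditioning on the length of the first block. The additive term stems from first blocks of zeros
  that reach beyond time \<open>n\<close>; a first block of ones that does so contributes nothing.\<close>

lemma nu_renewal_False:
  "nu_fps False = block_fps \<gamma> * nu_fps True + fps_const (1 / 2) * survival_fps \<gamma>"
proof (rule fps_ext)
  fix n
  have ex: "expo False = \<gamma>" by (simp add: expo_def)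
  have g: "1 < \<gamma>" using gamma by simp
  have X: "fps_X * fps_shift 1 (block_fps \<gamma>) = block_fps \<gamma>"
    using block_0[OF g] by (intro fps_ext) (auto simp: Suc_le_eq)
  have "nu_fps False $ n = (fps_X * (fps_shift 1 (block_fps \<gamma>) * nu_fps True)) $ n
      + (\<Sum>k. block_fps \<gamma> $ Suc (k + n) / 2)"
    using nu_fps_sums[of n False] unfolding ex by (intro sums_split) (simp cong: if_cong)
  also have "fps_X * (fps_shift 1 (block_fps \<gamma>) * nu_fps True) = block_fps \<gamma> * nu_fps True"
    unfolding mult.assoc[symmetric] X ..
  also have "(\<Sum>k. block_fps \<gamma> $ Suc (k + n) / 2) = survival_fps \<gamma> $ n / 2"
    unfolding survival_fps_def fps_nth_Abs_fps
    using suminf_divide[OF block_tail_summable[OF g, of n], of 2] by simp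
  finally show "nu_fps False $ n = (block_fps \<gamma> * nu_fps True + fps_const (1 / 2) * survival_fps \<gamma>) $ n"
    by simp
qed

lemma nu_renewal_True: "nu_fps True = block_fps \<delta> * nu_fps False"
proof (rule fps_ext)
  fix n
  have ex: "expo True = \<delta>" by (simp add: expo_def)
  have g: "1 < \<delta>" using delta by simp
  have X: "fps_X * fps_shift 1 (block_fps \<delta>) = block_fps \<delta>"
    using block_0[OF g] by (intro fps_ext) (auto simp: Suc_le_eq)
  have "nu_fps True $ n = (fps_X * (fps_shift 1 (block_fps \<delta>) * nu_fps False)) $ n + (\<Sum>k. 0)"
    using nu_fps_sums[of n True] unfolding ex by (intro sums_split) (simp cong: if_cong)
  also have "fps_X * (fps_shift 1 (block_fps \<delta>) * nu_fps False) = block_fps \<delta> * nu_fps False"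
    unfolding mult.assoc[symmetric] X ..
  finally show "nu_fps True $ n = (block_fps \<delta> * nu_fps False) $ n" by simp
qed

lemma weighted_renewal_True: "weighted_fps True = fps_X * (survival_fps \<delta> * nu_fps False)"
proof (rule fps_ext)
  fix n
  have ex: "expo True = \<delta>" by (simp add: expo_def)
  have "weighted_fps True $ n = (fps_X * (survival_fps \<delta> * nu_fps False)) $ n + (\<Sum>k. 0)"
    using weighted_fps_sums[of n True] unfolding ex by (intro sums_split) (simp cong: if_cong)
  then show "weighted_fps True $ n = (fps_X * (survival_fps \<delta> * nu_fps False)) $ n" by simp
qed

lemma weighted_renewal_False:
  "(1 - fps_X) * weighted_fps False = (1 - fps_X) * (fps_X * (survival_fps \<gamma> * nu_fps True))
     + fps_const (1 / 2) * (fps_const (mean False) - fps_X * survival_fps \<gamma>)"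
proof -
  have ex: "expo False = \<gamma>" by (simp add: expo_def)
  define R where "R = Abs_fps (\<lambda>n. (mean False - (\<Sum>k<n. survival_fps \<gamma> $ k)) / 2)"
  note sums = survival_sums[of False, unfolded ex]
  have R_nth: "R $ n = (mean False - (\<Sum>k<n. survival_fps \<gamma> $ k)) / 2" for n
    by (simp add: R_def)
  have "weighted_fps False = fps_X * (survival_fps \<gamma> * nu_fps True) + R"
  proof (rule fps_ext)
    fix n
    have "weighted_fps False $ n = (fps_X * (survival_fps \<gamma> * nu_fps True)) $ n + (\<Sum>k. survival_fps \<gamma> $ (k + n) / 2)"
      using weighted_fps_sums[of n False] unfolding ex by (intro sums_split) (simp cong: if_cong)
    also have "(\<Sum>k. survival_fps \<gamma> $ (k + n) / 2) = R $ n"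
      unfolding R_nth
      using suminf_divide[OF summable_ignore_initial_segment[OF sums_summable[OF sums], of n], of 2]
        suminf_minus_initial_segment[OF sums_summable[OF sums], of n] sums_unique[OF sums] by simp
    finally show "weighted_fps False $ n = (fps_X * (survival_fps \<gamma> * nu_fps True) + R) $ n" by simp
  qed
  moreover have "(1 - fps_X) * R = fps_const (1 / 2) * (fps_const (mean False) - fps_X * survival_fps \<gamma>)"
  proof (rule fps_ext)
    fix n
    show "((1 - fps_X) * R) $ n = (fps_const (1 / 2) * (fps_const (mean False) - fps_X * survival_fps \<gamma>)) $ n"
    proof (cases n)
      case 0
      then show ?thesis by (simp add: R_nth)
    next
      case (Suc m)
      have "((1 - fps_X) * R) $ Suc m = R $ Suc m - R $ m" by (simp add: left_diff_distrib)
      then show ?thesis unfolding Suc R_nth by (simp add: field_simps)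
    qed
  qed
  ultimately show ?thesis by (simp only: distrib_left)
qed

text \<open>The elimination of \<open>x\<close> and \<open>y\<close> from the four renewal equations. The first conclusion describes the
  probability of seeing zeros at times \<open>0\<close> and \<open>n\<close>, the second one expresses that the probability of a
  zero at time \<open>n\<close> does not depend on \<open>n\<close>.\<close>

lemma renewal_algebra:
  fixes X A B a b x y c d D m h :: "'a::idom"
  assumes "a = 1 - (1 - X) * A" "b = 1 - (1 - X) * B" "D = A + B - (1 - X) * (A * B)"
    and "x = a * y + h * A" "y = b * x"
    and "(1 - X) * c = (1 - X) * (X * (A * y)) + h * (m - X * A)" "d = X * (B * x)"
  shows "D * ((1 - X) * c) = h * (m * D - X * (A * B))"
    and "D * ((1 - X) * (c + d)) = h * (m * D)"
proof -
  have x: "(1 - X) * D * x = h * A" using assms(1-5) by algebra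
  show 1: "D * ((1 - X) * c) = h * (m * D - X * (A * B))" using assms x by algebra
  show "D * ((1 - X) * (c + d)) = h * (m * D)" using 1 assms(7) x by algebra
qed

definition prob_zero :: real where "prob_zero = mean False / (mean False + mean True)"

text \<open>The covariances at all times, up to the factor \<open>1 / (mean False + mean True)\<close>.\<close>

definition cov_fps :: "real fps" where
  "cov_fps = fps_const 2 * (weighted_fps False - fps_const prob_zero * (weighted_fps False + weighted_fps True))"

lemma cov_fps_eq:
  "cycle_fps \<gamma> \<delta> * ((1 - fps_X) * cov_fps)
     = fps_const (mean False * mean True / (mean False + mean True)) * cycle_fps \<gamma> \<delta>
       - fps_X * (survival_fps \<gamma> * survival_fps \<delta>)"
proof -
  have g: "1 < \<gamma>" "1 < \<delta>" using gamma delta by auto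
  let ?D = "cycle_fps \<gamma> \<delta>" and ?V = "fps_X * (survival_fps \<gamma> * survival_fps \<delta>)"
  let ?h = "fps_const (1 / 2) :: real fps" and ?m = "fps_const (mean False)" and ?p = "fps_const prob_zero"
  note alg = renewal_algebra[OF block_eq[OF g(1)] block_eq[OF g(2)] cycle_fps_def
    nu_renewal_False nu_renewal_True weighted_renewal_False weighted_renewal_True]
  have lin: "D * ((1 - X) * (t * (c - p * (c + d)))) = t * (D * ((1 - X) * c) - p * (D * ((1 - X) * (c + d))))"
    for D X t c p d :: "real fps" by algebra
  have "?D * ((1 - fps_X) * cov_fps) = fps_const 2 * (?h * (?m * ?D - ?V) - ?p * (?h * (?m * ?D)))"
    unfolding cov_fps_def lin alg ..
  also have "\<dots> = (fps_const 2 * ?h) * ((?m - ?p * ?m) * ?D - ?V)"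
  proof -
    have "t * (h * (m * D - V) - p * (h * (m * D))) = (t * h) * ((m - p * m) * D - V)"
      for t h m D V p :: "real fps" by algebra
    then show ?thesis .
  qed
  also have "fps_const 2 * ?h = 1" by simp
  also have "?m - ?p * ?m = fps_const (mean False * mean True / (mean False + mean True))"
  proof -
    have "mean False + mean True \<noteq> 0" using mean_ge_1[of True] mean_ge_1[of False] by simp
    then have "mean False - prob_zero * mean False = mean False * mean True / (mean False + mean True)"
      by (simp add: prob_zero_def field_simps)
    then show ?thesis by simp
  qed
  finally show ?thesis by (simp only: mult_1_left)
qed

lemma emeasure_equilibrium:
  assumes S: "S \<in> sets borel"
  shows "emeasure (equilibrium \<gamma> \<delta> \<nu>) S = ennreal (2 / (mean False + mean True) * measure weighted S)"
proof -
  interpret W: finite_measure weighted by (rule finite_weighted)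
  let ?Z = "\<integral>\<^sup>+ y. eigenfunction \<gamma> \<delta> y \<partial>\<nu>"
  have m: "0 < mean False + mean True" using mean_ge_1[of True] mean_ge_1[of False] by simp
  have "emeasure weighted UNIV = ?Z"
    unfolding weighted_def by (subst emeasure_density) (auto)
  then have Z: "?Z = ennreal ((mean False + mean True) / 2)" by (simp add: emeasure_weighted_UNIV)
  have "emeasure (equilibrium \<gamma> \<delta> \<nu>) S = (\<integral>\<^sup>+ x. eigenfunction \<gamma> \<delta> x / ?Z * indicator S x \<partial>\<nu>)"
    unfolding equilibrium_def using S by (intro emeasure_density) auto
  also have "\<dots> = (\<integral>\<^sup>+ x. (eigenfunction \<gamma> \<delta> x * indicator S x) / ?Z \<partial>\<nu>)"
    by (intro nn_integral_cong) (auto simp: indicator_def)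
  also have "\<dots> = (\<integral>\<^sup>+ x. eigenfunction \<gamma> \<delta> x * indicator S x \<partial>\<nu>) / ?Z"
    using S by (intro nn_integral_divide) auto
  also have "(\<integral>\<^sup>+ x. eigenfunction \<gamma> \<delta> x * indicator S x \<partial>\<nu>) = emeasure weighted S"
    unfolding weighted_def using S by (intro emeasure_density[symmetric]) auto
  also have "emeasure weighted S / ?Z = ennreal (2 / (mean False + mean True) * measure weighted S)"
    unfolding Z W.emeasure_eq_measure using m by (subst divide_ennreal) (auto simp: mult.commute)
  finally show ?thesis .
qed

lemma covariance_eq:
  assumes mu: "\<mu> = equilibrium \<gamma> \<delta> \<nu>"
  shows "(\<integral>x. indicator cyl0 ((shift ^^ q) x) * (indicator cyl0 x - measure \<mu> cyl0) \<partial>\<mu>)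
    = cov_fps $ q / (mean False + mean True)"
proof -
  have m: "0 < mean False + mean True" using mean_ge_1[of True] mean_ge_1[of False] by simp
  have sets: "sets \<mu> = sets borel" "space \<mu> = UNIV" by (simp_all add: mu equilibrium_def)
  have meas: "measure \<mu> S = 2 / (mean False + mean True) * measure weighted S" if "S \<in> sets borel" for S
    unfolding mu measure_def[of "equilibrium \<gamma> \<delta> \<nu>"] emeasure_equilibrium[OF that] using m by simp
  interpret mu: finite_measure \<mu>
    by (rule finite_measureI) (simp only: sets(2), simp add: mu emeasure_equilibrium)
  interpret W: finite_measure weighted by (rule finite_weighted)
  have cyl: "cyl0 = start False" by (auto simp: cyl0_def start_def)
  have "measure weighted (start False) = mean False / 2"
    unfolding measure_def emeasure_weighted_start using mean_ge_1[of False] by simp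
  then have p: "measure \<mu> cyl0 = prob_zero" unfolding cyl by (simp add: meas prob_zero_def)
  have W: "measure weighted (zero_at q) = weighted_fps False $ q + weighted_fps True $ q"
  proof -
    have eq: "zero_at q = (zero_at q \<inter> start False) \<union> (zero_at q \<inter> start True)" by (auto simp: start_def)
    have "measure weighted ((zero_at q \<inter> start False) \<union> (zero_at q \<inter> start True))
        = measure weighted (zero_at q \<inter> start False) + measure weighted (zero_at q \<inter> start True)"
      by (rule W.finite_measure_Union) (simp, simp, auto simp: start_def)
    then show ?thesis unfolding eq[symmetric] weighted_fps_def by simp
  qed
  have "(\<integral>x. indicator cyl0 ((shift ^^ q) x) * (indicator cyl0 x - measure \<mu> cyl0) \<partial>\<mu>)
      = (\<integral>x. indicator (zero_at q \<inter> start False) x - prob_zero * indicator (zero_at q) x \<partial>\<mu>)"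
    unfolding p
    by (intro Bochner_Integration.integral_cong refl)
      (auto simp: indicator_def cyl0_def zero_at_def start_def funpow_shift)
  also have "\<dots> = measure \<mu> (zero_at q \<inter> start False) - prob_zero * measure \<mu> (zero_at q)"
  proof -
    have int: "integrable \<mu> (indicator S :: binseq \<Rightarrow> real)" if "S \<in> sets borel" for S
      using that by (simp add: sets mu.emeasure_eq_measure)
    show ?thesis
      by (subst Bochner_Integration.integral_diff)
        (auto intro!: int integrable_mult_right simp: sets)
  qed
  also have "\<dots> = 2 / (mean False + mean True) * (weighted_fps False $ q - prob_zero * (weighted_fps False $ q + weighted_fps True $ q))"
    using W by (simp add: meas weighted_fps_def right_diff_distrib)
  also have "\<dots> = cov_fps $ q / (mean False + mean True)"
    by (simp add: cov_fps_def)
  finally show ?thesis .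
qed

end

theorem mainTheorem8:
  fixes \<gamma> \<delta> :: real and \<nu> \<mu> :: "binseq measure"
  assumes "2 < \<delta>" and "\<delta> < \<gamma>"
    and "eigenprobability (double_hofbauer \<gamma> \<delta>) \<nu>"
    and "\<mu> = equilibrium \<gamma> \<delta> \<nu>"
  shows "\<exists>c C :: real. 0 < c \<and> c \<le> C \<and>
    (\<forall>\<^sub>F q in sequentially.
       c * real q powr (2 - \<delta>)
         \<le> (\<integral>x. indicator cyl0 ((shift ^^ q) x) * (indicator cyl0 x - measure \<mu> cyl0) \<partial>\<mu>) \<and>
       (\<integral>x. indicator cyl0 ((shift ^^ q) x) * (indicator cyl0 x - measure \<mu> cyl0) \<partial>\<mu>)
         \<le> C * real q powr (2 - \<delta>))"
proof -
  interpret hofbauer_eigenmeasure \<gamma> \<delta> \<nu>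
    using assms(1-3) by unfold_locales auto
  have m: "0 < mean False + mean True" using mean_ge_1[of True] mean_ge_1[of False] by simp
  have "mean False = fps_value (survival_fps \<gamma>) 1" "mean True = fps_value (survival_fps \<delta>) 1"
    by (simp_all add: mean_def expo_def)
  from covariance_asymptotics[OF assms(1,2) cov_fps_eq[unfolded this]]
  obtain L where L: "0 < L" "(\<lambda>n. real n powr (\<delta> - 2) * cov_fps $ n) \<longlonglongrightarrow> L" by blast
  define l where "l = L / (mean False + mean True)"
  have l: "0 < l" using L m by (simp add: l_def)
  define I where "I = (\<lambda>q. \<integral>x. indicator cyl0 ((shift ^^ q) x) * (indicator cyl0 x - measure \<mu> cyl0) \<partial>\<mu>)"
  have "(\<lambda>q. real q powr (\<delta> - 2) * I q) \<longlonglongrightarrow> l"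
    using tendsto_divide[OF L(2) tendsto_const, of "mean False + mean True"] m
    unfolding I_def covariance_eq[OF assms(4)] l_def by simp
  then have "\<forall>\<^sub>F q in sequentially. dist (real q powr (\<delta> - 2) * I q) l < l / 2"
    by (rule tendstoD) (use l in simp)
  then have "\<forall>\<^sub>F q in sequentially. l / 2 * real q powr (2 - \<delta>) \<le> I q \<and> I q \<le> 2 * l * real q powr (2 - \<delta>)"
    using eventually_gt_at_top[of 0]
  proof eventually_elim
    case (elim q)
    define w where "w = real q powr (2 - \<delta>)"
    define T where "T = real q powr (\<delta> - 2) * I q"
    have "T * w = (real q powr (\<delta> - 2) * real q powr (2 - \<delta>)) * I q"
      unfolding T_def w_def by (simp only: mult_ac)
    also have "real q powr (\<delta> - 2) * real q powr (2 - \<delta>) = 1"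
      unfolding powr_add[symmetric] using elim(2) by simp
    finally have I: "I q = T * w" by simp
    have T: "l / 2 \<le> T" "T \<le> 2 * l"
      using elim(1) l unfolding dist_real_def T_def by linarith+
    have w: "0 \<le> w" by (simp add: w_def)
    show ?case unfolding w_def[symmetric] I
      using mult_right_mono[OF T(1) w] mult_right_mono[OF T(2) w] by (rule conjI)
  qed
  then show ?thesis using l unfolding I_def by (intro exI[of _ "l / 2"] exI[of _ "2 * l"]) simp
qed

end
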